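(* For every integer $m\ge 1$ and every integer $c\ge 1$ there exists $s_0$ such that for all integers $s\ge s_0$, with $n=ms+c$ and $\ell=s-c$, \[ e(n,s)=|\mathcal Q(m,s,\ell)|. \] Moreover: \begin{itemize} \item if $c\ge 2$, then $\mathcal Q(m,s,\ell)$ is the unique shifted family $\mathcal F\subset 2^{[n]}$ with $\nu(\mathcal F)<s$ and $|\mathcal F|=e(n,s)$; \item if $c=1$, then $\mathcal Q(m,s,\ell)$ and $\mathcal W(m,s,\ell)$ are the only shifted families $\mathcal F\subset 2^{[n]}$ with $\nu(\mathcal F)<s$ and $|\mathcal F|=e(n,s)$. \end{itemize}
   Context: For integers $a\le b$, $[a,b]=\{a,\dots,b\}$ and $[b]=[1,b]$. A matching is a collection of pairwise disjoint sets; $\nu(\mathcal F)$ is the maximum size of a matching contained in the family $\mathcal F$. Define \[ e(n,s)=\max\{|\mathcal F|:\mathcal F\subset 2^{[n]},\ \nu(\mathcal F)<s\}. \] For $n=ms+c$ with $1\le c\le s$ and $\ell=s-c$, define \[ \mathcal Q(m,s,\ell)=\{P\subset[n]: |P|+|P\cap[ms-c-1]|\ge 2m\},\qquad \mathcal W(m,s,\ell)=\{P\subset[n]: |P\cap[ms-1]|\ge m\}. \] Writing a set as $(a_1,\dots,a_k)$ with $a_1<\dots<a_k$, a set $(a_1,\dots,a_k)$ can be shifted to $(b_1,\dots,b_k)$ if $a_i\ge b_i$ for all $i\in[k]$. A family $\mathcal F$ is shifted if whenever $A\in\mathcal F$ and $A$ can be shifted to $B$, then $B\in\mathcal F$. 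*)

theory Defs
  imports Main "HOL-Library.Disjoint_Sets"
begin

definition matching_number :: "'a set set \<Rightarrow> nat" where
  "matching_number F = Max {card M | M. M \<subseteq> F \<and> disjoint M}"

definition max_family_size :: "nat \<Rightarrow> nat \<Rightarrow> nat" where
  "max_family_size n s =
     Max {card F | F. F \<subseteq> Pow {1..n} \<and> matching_number F < s}"

text \<open>
  Sets are finite sets of positive integers; without this restriction an element 1
  could be shifted to 0, outside every ground set \<open>{1..n}\<close>.
\<close>

definition can_be_shifted_to :: "nat set \<Rightarrow> nat set \<Rightarrow> bool" where
  "can_be_shifted_to A B \<longleftrightarrow>
     finite A \<and> finite B \<and> A \<subseteq> {1..} \<and> B \<subseteq> {1..} \<and>
     list_all2 (\<lambda>a b. a \<ge> b) (sorted_list_of_set A) (sorted_list_of_set B)"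

definition shifted :: "nat set set \<Rightarrow> bool" where
  "shifted F \<longleftrightarrow> (\<forall>A\<in>F. \<forall>B. can_be_shifted_to A B \<longrightarrow> B \<in> F)"

text \<open>
  Both families live on \<open>{1..n}\<close> with \<open>n = m * s + c\<close>, where \<open>c = s - l\<close>.
  Truncated subtraction in \<open>m * s - c - 1\<close> is harmless: a nonpositive upper bound
  gives the empty interval either way.
\<close>

definition Q_family :: "nat \<Rightarrow> nat \<Rightarrow> nat \<Rightarrow> nat set set" where
  "Q_family m s l = (let c = s - l in
     {P. P \<subseteq> {1..m * s + c} \<and> card P + card (P \<inter> {1..m * s - c - 1}) \<ge> 2 * m})"

definition W_family :: "nat \<Rightarrow> nat \<Rightarrow> nat \<Rightarrow> nat set set" where
  "W_family m s l = (let c = s - l in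
     {P. P \<subseteq> {1..m * s + c} \<and> card (P \<inter> {1..m * s - 1}) \<ge> m})"

end

theory Submission
  imports Defs Complex_Main
begin

text \<open>
  A maximum family is upward closed and, after compressions, closed under replacing an element by a
  smaller one. Fix a constant \<open>L\<close>, large in terms of \<open>m\<close> and \<open>c\<close>, and call the last \<open>L\<close> points of
  \<open>{1..n}\<close> the tail. The family \<open>Q\<close> omits only \<open>(2c + 2 + o(1)) binom(ms, m - 1)\<close> sets,
  so a maximum family \<open>F\<close> contains every \<open>m\<close>-set that avoids the tail and has at most one element
  above \<open>n - s\<close>. Let \<open>G\<close> consist of the subsets \<open>D\<close> of the tail whose union with some
  fixed \<open>(m - 1)\<close>-set of small elements lies in \<open>F\<close>. Disjoint members of \<open>G\<close> can be completed by such
  \<open>m\<close>-sets to a large matching, so \<open>G\<close> has no \<open>L - c\<close> disjoint members. Every subset of the tail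
  outside \<open>G\<close> costs \<open>F\<close> about \<open>binom(ms, m - 1)\<close> sets, so at most \<open>2c + 2\<close> subsets are outside \<open>G\<close>.
  This instance of the problem with \<open>m = 1\<close> has only the solutions coming from \<open>Q\<close> and, if \<open>c = 1\<close>, from \<open>W\<close>.
  Knowing \<open>G\<close>, any member of \<open>F\<close> outside \<open>Q\<close> (or \<open>W\<close>) extends to a matching of size \<open>s\<close>,
  hence \<open>F\<close> is contained in \<open>Q\<close> (or \<open>W\<close>).
\<close>

section \<open>Matchings and compressed families\<close>

text \<open>Indexing by \<open>{..<k}\<close> makes matchings easy to concatenate and to alter at
  one index. The index function need not be injective, so the empty set could be repeated; agreement
  with \<open>matching_number\<close> is therefore claimed only for families without the empty
  set.\<close>

definition has_matching :: "nat \<Rightarrow> 'a set set \<Rightarrow> bool" where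
  "has_matching k F \<longleftrightarrow> (\<exists>f. (\<forall>i<k. f i \<in> F) \<and> disjoint_family_on f {..<k})"

lemma matching_number_less_iff_card:
  assumes "finite F"
  shows "matching_number F < s \<longleftrightarrow> (\<forall>M\<subseteq>F. disjoint M \<longrightarrow> card M < s)"
proof -
  have fin: "finite {card M | M. M \<subseteq> F \<and> disjoint M}"
  proof (rule finite_subset)
    show "{card M | M. M \<subseteq> F \<and> disjoint M} \<subseteq> card ` Pow F" by auto
    show "finite (card ` Pow F)" using assms by simp
  qed
  have "card {} \<in> {card M | M. M \<subseteq> F \<and> disjoint M}"
    by (intro CollectI exI[of _ "{}"]) simp
  hence ne: "{card M | M. M \<subseteq> F \<and> disjoint M} \<noteq> {}" by blast
  show ?thesis
    unfolding matching_number_def Max_less_iff[OF fin ne] by auto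
qed

lemma matching_number_less_iff:
  assumes "finite F" and "{} \<notin> F"
  shows "matching_number F < s \<longleftrightarrow> \<not> has_matching s F"
proof -
  have "has_matching s F \<longleftrightarrow> (\<exists>M\<subseteq>F. disjoint M \<and> s \<le> card M)"
  proof
    assume "has_matching s F"
    then obtain f where f: "\<And>i. i < s \<Longrightarrow> f i \<in> F" and d: "disjoint_family_on f {..<s}"
      unfolding has_matching_def by blast
    have inj: "inj_on f {..<s}"
    proof (rule inj_onI)
      fix i j assume ij: "i \<in> {..<s}" "j \<in> {..<s}" "f i = f j"
      show "i = j"
      proof (rule ccontr)
        assume "i \<noteq> j"
        hence "f i \<inter> f j = {}" using d ij by (auto simp: disjoint_family_on_def)
        thus False using f[of i] ij assms(2) by auto
      qed
    qed
    have "disjoint (f ` {..<s})" by (rule disjoint_family_on_disjoint_image[OF d])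
    moreover have "card (f ` {..<s}) = s" using inj by (simp add: card_image)
    ultimately show "\<exists>M\<subseteq>F. disjoint M \<and> s \<le> card M"
      using f by (intro exI[of _ "f ` {..<s}"] conjI) auto
  next
    assume "\<exists>M\<subseteq>F. disjoint M \<and> s \<le> card M"
    then obtain M where M: "M \<subseteq> F" "disjoint M" "s \<le> card M" by blast
    have "finite M" using M(1) assms(1) finite_subset by blast
    then obtain h where h: "bij_betw h {0..<card M} M" using ex_bij_betw_nat_finite by blast
    have "h i \<in> F" if "i < s" for i
      using bij_betwE[OF h] that M(1,3) by auto
    moreover have "disjoint_family_on h {..<s}"
    proof (unfold disjoint_family_on_def, intro ballI impI)
      fix i j assume ij: "i \<in> {..<s}" "j \<in> {..<s}" "i \<noteq> j"
      have "h i \<in> M" "h j \<in> M" using bij_betwE[OF h] ij M(3) by auto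
      moreover have "h i \<noteq> h j"
        using inj_onD[OF bij_betw_imp_inj_on[OF h], of i j] ij M(3) by auto
      ultimately show "h i \<inter> h j = {}" using M(2) by (simp add: disjointD)
    qed
    ultimately show "has_matching s F" unfolding has_matching_def by blast
  qed
  thus ?thesis
    unfolding matching_number_less_iff_card[OF assms(1)] not_less[symmetric] by blast
qed

lemma disjoint_family_onI_less:
  fixes f :: "nat \<Rightarrow> 'a set"
  assumes "\<And>i j. i < j \<Longrightarrow> j < k \<Longrightarrow> f i \<inter> f j = {}"
  shows "disjoint_family_on f {..<k}"
  unfolding disjoint_family_on_def
proof (intro ballI impI)
  fix i j assume "i \<in> {..<k}" "j \<in> {..<k}" "i \<noteq> j"
  thus "f i \<inter> f j = {}" using assms[of i j] assms[of j i] by (cases i j rule: linorder_cases) auto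
qed

lemma disjoint_equal_parts:
  assumes "finite S" and "a * k \<le> card S"
  shows "\<exists>f. (\<forall>i<k. f i \<subseteq> S \<and> card (f i) = a) \<and> disjoint_family_on f {..<k}"
  using assms
proof (induction k arbitrary: S)
  case 0
  show ?case by (simp add: disjoint_family_on_def)
next
  case (Suc k)
  have "a \<le> card S" using Suc.prems(2) by simp
  then obtain T where T: "T \<subseteq> S" "card T = a"
    by (rule obtain_subset_with_card_n)
  have finT: "finite T" using T Suc.prems finite_subset by blast
  have "a * k \<le> card (S - T)"
    using Suc.prems T finT by (simp add: card_Diff_subset)
  then obtain f where f: "\<forall>i<k. f i \<subseteq> S - T \<and> card (f i) = a" "disjoint_family_on f {..<k}"
    using Suc.IH[of "S - T"] Suc.prems(1) by blast
  have "disjoint_family_on (f(k := T)) {..<Suc k}"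
  proof (rule disjoint_family_onI_less)
    fix i j assume ij: "i < j" "j < Suc k"
    show "(f(k := T)) i \<inter> (f(k := T)) j = {}"
    proof (cases "j = k")
      case True
      thus ?thesis using f(1) ij by auto
    next
      case False
      thus ?thesis using disjoint_family_onD[OF f(2), of i j] ij by auto
    qed
  qed
  moreover have "\<forall>i<Suc k. (f(k := T)) i \<subseteq> S \<and> card ((f(k := T)) i) = a"
    using f T by (auto simp: less_Suc_eq)
  ultimately show ?case by blast
qed

text \<open>\<open>swap\<close> is one elementary step of shifting. Using it in place of sorted
  lists lets one argument serve both shifted families and families obtained by compression.\<close>

locale compressed_family =
  fixes F :: "nat set set" and n :: nat
  assumes sub: "F \<subseteq> Pow {1..n}"
    and up: "\<And>A B. A \<in> F \<Longrightarrow> A \<subseteq> B \<Longrightarrow> B \<subseteq> {1..n} \<Longrightarrow> B \<in> F"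
    and swap: "\<And>A x y. A \<in> F \<Longrightarrow> x \<in> A \<Longrightarrow> y \<notin> A \<Longrightarrow> 1 \<le> y \<Longrightarrow> y < x \<Longrightarrow> insert y (A - {x}) \<in> F"
begin

text \<open>The elements of \<open>A\<close> are exchanged one at a time, each new element joining
  the fixed part \<open>C\<close>. Since all of \<open>B\<close> lies below all of \<open>A\<close>,
  any pairing of the two sets works and no order has to be tracked.\<close>

lemma replace_by_smaller:
  assumes "finite A" and "C \<union> A \<in> F" and "finite B" and "card B = card A"
    and "A \<inter> C = {}" and "B \<inter> C = {}" and "\<And>a b. a \<in> A \<Longrightarrow> b \<in> B \<Longrightarrow> b < a" and "0 \<notin> B"
  shows "C \<union> B \<in> F"
  using assms
proof (induction A arbitrary: B C rule: finite_induct)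
  case empty
  then show ?case by auto
next
  case (insert a A)
  note hyp = insert.prems
  have "B \<noteq> {}" using hyp(3) insert.hyps by auto
  then obtain b where b: "b \<in> B" by blast
  have lt: "b < a'" if "a' \<in> insert a A" for a' using hyp(6)[OF that b] .
  have b_new: "b \<notin> C" "b \<noteq> a" "b \<notin> A" "a \<notin> C"
    using b hyp(4,5) lt by blast+
  have b1: "1 \<le> b" using b hyp(7) by (cases b) auto
  have "insert b ((C \<union> insert a A) - {a}) \<in> F"
    by (rule swap[OF hyp(1)]) (use b_new lt b1 in simp_all)
  moreover have "insert b ((C \<union> insert a A) - {a}) = insert b C \<union> A"
    using insert.hyps(2) b_new by blast
  ultimately have 1: "insert b C \<union> A \<in> F" by simp
  have 2: "finite (B - {b})" "card (B - {b}) = card A"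
    using b hyp(2,3) insert.hyps by simp_all
  have "insert b C \<union> (B - {b}) \<in> F"
  proof (rule insert.IH[OF 1 2])
    show "A \<inter> insert b C = {}" using hyp(4) b_new by blast
    show "(B - {b}) \<inter> insert b C = {}" using hyp(5) by blast
    show "b' < a'" if "a' \<in> A" "b' \<in> B - {b}" for a' b'
      using hyp(6)[of a' b'] that by blast
    show "0 \<notin> B - {b}" using hyp(7) by blast
  qed
  moreover have "insert b C \<union> (B - {b}) = C \<union> B" using b by blast
  ultimately show ?case by simp
qed

text \<open>Prescribed traces \<open>g i\<close> on the tail are completed by (m-1)-sets from
  \<open>{1..r}\<close>, and \<open>k\<close> generic m-sets off the tail are added.
  \<open>Y\<close> is kept free: it is empty or a member of \<open>F\<close> that is to join the
  matching. The first inequality on \<open>k\<close> says that there are enough points below the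
  tail.\<close>

lemma completion:
  fixes g :: "nat \<Rightarrow> nat set"
  assumes generic: "\<And>B x. B \<subseteq> {1..n-s} \<Longrightarrow> card B = m - 1 \<Longrightarrow> x \<in> {1..n-L} - B \<Longrightarrow> insert x B \<in> F"
    and gF: "\<And>i A. i < p \<Longrightarrow> A \<subseteq> {1..r} \<Longrightarrow> card A = m - 1 \<Longrightarrow> A \<union> g i \<in> F"
    and gT: "\<And>i. i < p \<Longrightarrow> g i \<subseteq> {n-L<..n}"
    and gd: "disjoint_family_on g {..<p}"
    and gY: "\<And>i. i < p \<Longrightarrow> g i \<inter> Y = {}"
    and r: "r \<le> n - L" "(m - 1) * p + card (Y \<inter> {1..r}) \<le> r"
    and k: "m * k + (m - 1) * p + card (Y \<inter> {1..n-L}) \<le> n - L" "s \<le> k + L"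
    and m: "m \<ge> 1" and s: "L \<le> s" "s \<le> n"
  shows "\<exists>f. (\<forall>i<p+k. f i \<in> F \<and> f i \<inter> Y = {}) \<and> disjoint_family_on f {..<p+k}"
proof -
  have "card ({1..r} - Y) = r - card (Y \<inter> {1..r})"
    by (simp add: card_Diff_subset_Int Int_commute)
  hence "(m - 1) * p \<le> card ({1..r} - Y)" using r by simp
  then obtain A where A: "\<And>i. i < p \<Longrightarrow> A i \<subseteq> {1..r} - Y" "\<And>i. i < p \<Longrightarrow> card (A i) = m - 1"
    and Ad: "disjoint_family_on A {..<p}"
    using disjoint_equal_parts[of "{1..r} - Y" "m - 1" p] by auto
  define V where "V = (\<Union>i<p. A i)"
  have "card V \<le> (\<Sum>i<p. card (A i))" unfolding V_def by (rule card_UN_le) simp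
  also have "\<dots> = (m - 1) * p" using A(2) by simp
  finally have cV: "card V \<le> (m - 1) * p" .
  have Vsub: "V \<subseteq> {1..n-L}" using A(1) r unfolding V_def by fastforce
  have finV: "finite V" using Vsub finite_subset by blast
  define R where "R = {1..n-L} - Y - V"
  have R_eq: "R = {1..n-L} - ((Y \<inter> {1..n-L}) \<union> V)" unfolding R_def by auto
  have "card R = (n - L) - card ((Y \<inter> {1..n-L}) \<union> V)"
    unfolding R_eq using Vsub finV by (subst card_Diff_subset) auto
  moreover have "card ((Y \<inter> {1..n-L}) \<union> V) \<le> card (Y \<inter> {1..n-L}) + (m - 1) * p"
    using cV card_Un_le[of "Y \<inter> {1..n-L}" V] by linarith
  ultimately have cR: "m * k \<le> card R" using k(1) by linarith
  have finR: "finite R" unfolding R_def by simp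
  \<comment> \<open>A generic set tolerates only one point above \<open>n-s\<close>. The free points
    there number at most \<open>s-L\<close>, hence at most \<open>k\<close>, so a
    \<open>k\<close>-set \<open>T\<close> can absorb them all. Each generic set then takes one point
    of \<open>T\<close> and its other points from \<open>{1..n-s}\<close>.\<close>
  have "R \<inter> {n-s<..} \<subseteq> {n-s<..n-L}" unfolding R_def by auto
  hence "card (R \<inter> {n-s<..}) \<le> card {n-s<..n-L}" by (rule card_mono[rotated]) simp
  also have "\<dots> \<le> k" using k s by simp
  finally have "card (R \<inter> {n-s<..}) \<le> k" .
  moreover have kR: "k \<le> card R" using cR m by (cases m) auto
  ultimately obtain T where T: "R \<inter> {n-s<..} \<subseteq> T" "T \<subseteq> R" "card T = k"
    using exists_subset_between[of "R \<inter> {n-s<..}" k R] finR by auto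
  have finT: "finite T" using T finR finite_subset by blast
  have "m * k = (m - 1) * k + k" using m by (cases m) auto
  hence "(m - 1) * k \<le> card (R - T)"
    using cR T finT by (simp add: card_Diff_subset)
  then obtain B where B: "\<And>i. i < k \<Longrightarrow> B i \<subseteq> R - T" "\<And>i. i < k \<Longrightarrow> card (B i) = m - 1"
    and Bd: "disjoint_family_on B {..<k}"
    using disjoint_equal_parts[of "R - T" "m - 1" k] finR by auto
  have Blow: "R - T \<subseteq> {1..n-s}" using T unfolding R_def by auto
  obtain h where h: "bij_betw h {0..<k} T" using ex_bij_betw_nat_finite[OF finT] T by auto
  have hT: "h i \<in> T" if "i < k" for i using h that by (auto simp: bij_betw_def)
  have hinj: "h i \<noteq> h j" if "i < k" "j < k" "i \<noteq> j" for i j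
    using h that by (auto simp: bij_betw_def inj_on_def)
  define f where "f i = (if i < p then A i \<union> g i else insert (h (i - p)) (B (i - p)))" for i
  have f1: "A i \<union> g i \<in> F" "(A i \<union> g i) \<inter> Y = {}" "(A i \<union> g i) \<inter> R = {}" if "i < p" for i
  proof -
    show "A i \<union> g i \<in> F" using gF[OF that] A that by blast
    show "(A i \<union> g i) \<inter> Y = {}" using A(1) gY that by blast
    have "A i \<subseteq> V" using that unfolding V_def by auto
    thus "(A i \<union> g i) \<inter> R = {}" using gT[OF that] unfolding R_def by fastforce
  qed
  have f2: "insert (h i) (B i) \<in> F" "insert (h i) (B i) \<subseteq> R" if "i < k" for i
  proof -
    show "insert (h i) (B i) \<subseteq> R" using hT[OF that] B(1)[OF that] T by auto
    show "insert (h i) (B i) \<in> F"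
    proof (rule generic)
      show "B i \<subseteq> {1..n-s}" using B(1)[OF that] Blow by blast
      show "card (B i) = m - 1" using B(2) that by blast
      show "h i \<in> {1..n-L} - B i" using hT[OF that] B(1)[OF that] T(2) unfolding R_def by auto
    qed
  qed
  have RY: "R \<inter> Y = {}" unfolding R_def by auto
  have "f i \<in> F \<and> f i \<inter> Y = {}" if "i < p + k" for i
  proof (cases "i < p")
    case True
    thus ?thesis using f1[of i] unfolding f_def by simp
  next
    case False
    hence "i - p < k" using that by simp
    thus ?thesis using f2[of "i - p"] RY False unfolding f_def by auto
  qed
  moreover have "f i \<inter> f j = {}" if "i < j" "j < p + k" for i j
  proof (cases "j < p")
    case True
    hence "A i \<inter> A j = {}" "g i \<inter> g j = {}"
      using Ad gd that by (auto simp: disjoint_family_on_def)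
    moreover have "A i \<inter> g j = {}" "g i \<inter> A j = {}"
      using A(1)[of i] A(1)[of j] gT[of i] gT[of j] True that r(1) by fastforce+
    ultimately show ?thesis using True that unfolding f_def by auto
  next
    case False
    show ?thesis
    proof (cases "i < p")
      case True
      have "j - p < k" using False that by simp
      hence "insert (h (j - p)) (B (j - p)) \<subseteq> R" by (rule f2(2))
      thus ?thesis using False True f1(3)[OF True] unfolding f_def by auto
    next
      case i: False
      have ij: "i - p < k" "j - p < k" "i - p \<noteq> j - p" using i False that by auto
      have "B (i - p) \<inter> B (j - p) = {}" using Bd ij by (auto simp: disjoint_family_on_def)
      moreover have "h (i - p) \<noteq> h (j - p)" using hinj ij by blast
      moreover have "h (i - p) \<notin> B (j - p)" "h (j - p) \<notin> B (i - p)"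
        using hT ij B(1) by blast+
      ultimately show ?thesis using i False unfolding f_def by auto
    qed
  qed
  hence "disjoint_family_on f {..<p+k}"
    by (intro disjoint_family_onI_less) simp
  ultimately show ?thesis by blast
qed

end

section \<open>The case m = 1\<close>

text \<open>The number \<open>u\<close> of missing singletons decides. A large \<open>u\<close> is
  costly by itself, a small \<open>u\<close> forces larger missing sets. The two exceptions, each
  with \<open>2 * c + 2\<close> missing sets, are the traces of \<open>Q\<close> and, for
  \<open>c = 1\<close>, of \<open>W\<close> on the tail.\<close>

lemma tail_family_dichotomy:
  fixes G :: "nat set set" and a L c :: nat
  defines "N \<equiv> Pow {a<..a+L} - G"
  assumes sub: "G \<subseteq> Pow {a<..a+L}"
    and up: "\<And>A B. A \<in> G \<Longrightarrow> A \<subseteq> B \<Longrightarrow> B \<subseteq> {a<..a+L} \<Longrightarrow> B \<in> G"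
    and swap: "\<And>A x y. A \<in> G \<Longrightarrow> x \<in> A \<Longrightarrow> y \<notin> A \<Longrightarrow> a < y \<Longrightarrow> y < x \<Longrightarrow> insert y (A - {x}) \<in> G"
    and nm: "\<not> has_matching (L - c) G"
    and c: "c \<ge> 1" and L: "2 * c + 1 \<le> L"
  shows "2 * c + 3 \<le> card N \<or> N = insert {} ((\<lambda>x. {x}) ` {a+L-(2*c+1)<..a+L})
     \<or> c = 1 \<and> N = Pow {a+L-2<..a+L}"
proof -
  \<comment> \<open>By \<open>swap\<close> the points with missing singletons form a final segment
    of the tail, and by \<open>up\<close> every missing set lies inside it.\<close>
  define U where "U = {x \<in> {a<..a+L}. {x} \<notin> G}"
  define u where "u = card U"
  define b where "b = a + L - u"
  have finN: "finite N" unfolding N_def by simp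
  have finU: "finite U" unfolding U_def by simp
  have Utop: "y \<in> U" if "x \<in> U" "x \<le> y" "y \<le> a + L" for x y
  proof (rule ccontr)
    assume "y \<notin> U"
    hence "{y} \<in> G" "x < y" using that unfolding U_def by (auto simp: order.order_iff_strict)
    hence "insert x ({y} - {y}) \<in> G" using that swap[of "{y}" y x] unfolding U_def by auto
    thus False using that unfolding U_def by auto
  qed
  have "card U \<le> card {a<..a+L}" unfolding U_def by (rule card_mono) auto
  hence uL: "u \<le> L" by (simp add: u_def)
  have U_eq: "U = {b<..a+L}"
  proof (cases "U = {}")
    case True
    then show ?thesis by (simp add: b_def u_def)
  next
    case False
    define x where "x = Min U"
    have x: "x \<in> U" "\<And>y. y \<in> U \<Longrightarrow> x \<le> y" using False finU unfolding x_def by auto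
    have ax: "a < x" "x \<le> a + L" using x unfolding U_def by auto
    have "U = {x..a+L}"
    proof
      show "U \<subseteq> {x..a+L}" using x(2) unfolding U_def by auto
      show "{x..a+L} \<subseteq> U" using Utop[OF x(1)] by auto
    qed
    moreover from this have "u = Suc (a + L) - x" unfolding u_def by simp
    ultimately show ?thesis using ax by (auto simp: b_def)
  qed
  have ab: "a \<le> b" "b + u = a + L" using uL by (auto simp: b_def)
  have single: "{x} \<in> G" if "a < x" "x \<le> b" for x
  proof -
    have "x \<notin> U" using U_eq that by simp
    thus ?thesis using that ab unfolding U_def by simp
  qed
  have NU: "D \<subseteq> U" if "D \<in> N" for D
  proof
    fix x assume "x \<in> D"
    have "D \<subseteq> {a<..a+L}" "D \<notin> G" using that unfolding N_def by auto
    thus "x \<in> U" using \<open>x \<in> D\<close> up[of "{x}" D] unfolding U_def by auto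
  qed
  \<comment> \<open>The \<open>L - u\<close> points below \<open>U\<close> have their singletons in
    \<open>G\<close>, so \<open>u - c\<close> disjoint members inside \<open>U\<close> would bring
    the total to \<open>L - c\<close>.\<close>
  have extend: "\<not> has_matching (u - c) {D \<in> G. D \<subseteq> U}" if "c \<le> u"
  proof
    assume "has_matching (u - c) {D \<in> G. D \<subseteq> U}"
    then obtain f where f: "\<And>i. i < u - c \<Longrightarrow> f i \<in> G \<and> f i \<subseteq> U" "disjoint_family_on f {..<u-c}"
      unfolding has_matching_def by blast
    define h where "h i = (if i < u - c then f i else {Suc a + (i - (u - c))})" for i
    have new: "a < Suc a + (i - (u - c))" "Suc a + (i - (u - c)) \<le> b"
      if "\<not> i < u - c" "i < L - c" for i
      using that \<open>c \<le> u\<close> ab uL by linarith+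
    have "h i \<in> G" if "i < L - c" for i
      using f(1)[of i] single new[of i] that unfolding h_def by auto
    moreover have "h i \<inter> h j = {}" if ij: "i < j" "j < L - c" for i j
    proof (cases "j < u - c")
      case True
      thus ?thesis using f(2) ij unfolding h_def disjoint_family_on_def by auto
    next
      case False
      have "Suc a + (j - (u - c)) \<notin> U" using new(2)[OF False ij(2)] U_eq by auto
      thus ?thesis using f(1)[of i] False ij unfolding h_def by auto
    qed
    hence "disjoint_family_on h {..<L-c}"
      by (intro disjoint_family_onI_less) simp
    ultimately show False using nm unfolding has_matching_def by blast
  qed
  have "c < u"
  proof (rule ccontr)
    assume "\<not> c < u"
    hence "L - c \<le> L - u" by simp
    have "has_matching (L - c) G"
      unfolding has_matching_def
    proof (intro exI[of _ "\<lambda>i. {Suc a + i}"] conjI allI impI)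
      fix i assume "i < L - c"
      thus "{Suc a + i} \<in> G" using single[of "Suc a + i"] \<open>L - c \<le> L - u\<close> ab by auto
    qed (auto simp: disjoint_family_on_def)
    thus False using nm by blast
  qed
  have "{} \<in> N"
  proof -
    have "{} \<notin> G"
    proof
      assume "{} \<in> G"
      hence "{b + u} \<in> G" by (rule up) (use \<open>c < u\<close> ab in auto)
      hence "b + u \<notin> U" unfolding U_def by simp
      thus False using U_eq ab \<open>c < u\<close> by simp
    qed
    thus ?thesis unfolding N_def by simp
  qed
  moreover have singN: "(\<lambda>x. {x}) ` U \<subseteq> N" unfolding N_def U_def by auto
  ultimately have base: "insert {} ((\<lambda>x. {x}) ` U) \<subseteq> N" by auto
  have card_base: "card (insert {} ((\<lambda>x. {x}) ` U)) = Suc u"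
    using finU by (simp add: card_image u_def image_iff)
  have uN: "Suc u \<le> card N" using card_mono[OF finN base] card_base by simp
  \<comment> \<open>In the first two cases the empty set and the singletons of \<open>U\<close>
    suffice. For \<open>u = c + 1\<close> every subset of \<open>U\<close> is missing, and for
    \<open>c + 2 \<le> u \<le> 2 * c\<close> enough pairs are missing.\<close>
  consider "2 * c + 2 \<le> u" | "u = 2 * c + 1" | "u \<le> 2 * c" "u - c = 1" | "u \<le> 2 * c" "u - c \<ge> 2"
    using \<open>c < u\<close> by linarith
  thus ?thesis
  proof cases
    case 1
    thus ?thesis using uN by simp
  next
    case 2
    show ?thesis
    proof (cases "2 * c + 3 \<le> card N")
      case False
      hence "card N = card (insert {} ((\<lambda>x. {x}) ` U))" using uN 2 card_base by simp
      hence "N = insert {} ((\<lambda>x. {x}) ` U)" using card_subset_eq[OF finN base] by simp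
      thus ?thesis unfolding U_eq b_def 2 by blast
    qed blast
  next
    case 3
    have "Pow U \<subseteq> N"
    proof
      fix D assume D: "D \<in> Pow U"
      have "D \<notin> G"
      proof
        assume "D \<in> G"
        hence "has_matching (u - c) {D \<in> G. D \<subseteq> U}"
          using D 3 unfolding has_matching_def disjoint_family_on_def by (intro exI[of _ "\<lambda>_. D"]) auto
        thus False using extend \<open>c < u\<close> by simp
      qed
      thus "D \<in> N" using D unfolding N_def U_def by auto
    qed
    hence NP: "N = Pow U" using NU by blast
    have "u = c + 1" using 3 by simp
    hence cN: "card N = 2 ^ (c + 1)" unfolding NP using finU by (simp add: card_Pow u_def[symmetric])
    show ?thesis
    proof (cases "c = 1")
      case True
      hence "u = 2" using \<open>u = c + 1\<close> by simp
      thus ?thesis using True NP unfolding U_eq b_def by simp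
    next
      case False
      have "2 * k + 3 \<le> (2::nat) ^ (k + 1)" if "k \<ge> 2" for k
        using that by (induction k rule: dec_induct) auto
      thus ?thesis using cN c False by simp
    qed
  next
    case 4
    define r where "r = u - c"
    have r: "2 \<le> r" "r \<le> c" "u = c + r" using 4 unfolding r_def by auto
    have low: "{x, y} \<in> G" if "{x', y'} \<in> G" "b < x" "x \<le> x'" "y \<le> y'" "x < y" "x' < y'" "y' \<le> b + u" for x y x' y'
    proof -
      have "{x, y'} \<in> G"
      proof (cases "x = x'")
        case False
        have "insert x ({x', y'} - {x'}) \<in> G"
          by (rule swap[OF that(1)]) (use that ab False in auto)
        moreover have "insert x ({x', y'} - {x'}) = {x, y'}" using that by auto
        ultimately show ?thesis by simp
      qed (use that in simp)
      show ?thesis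
      proof (cases "y = y'")
        case False
        have "insert y ({x, y'} - {y'}) \<in> G"
          by (rule swap[OF \<open>{x, y'} \<in> G\<close>]) (use that ab False in auto)
        moreover have "insert y ({x, y'} - {y'}) = {x, y}" using that by auto
        ultimately show ?thesis by simp
      qed (use that \<open>{x, y'} \<in> G\<close> in simp)
    qed
    \<comment> \<open>The \<open>r\<close> nested pairs \<open>{b + Suc i, b + 2 * r - i}\<close>
      partition the first \<open>2 * r\<close> points of \<open>U\<close>. Each arises from
      \<open>{b + r, b + 2 * r}\<close> by lowering elements, so this one pair would put a matching
      of size \<open>r = u - c\<close> into \<open>G\<close>.\<close>
    have key: "{b + r, b + 2 * r} \<notin> G"
    proof
      assume in_G: "{b + r, b + 2 * r} \<in> G"
      have "has_matching (u - c) {D \<in> G. D \<subseteq> U}"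
        unfolding has_matching_def
      proof (intro exI[of _ "\<lambda>i. {b + Suc i, b + 2 * r - i}"] conjI allI impI)
        fix i assume i: "i < u - c"
        have "{b + Suc i, b + 2 * r - i} \<in> G"
          by (rule low[OF in_G]) (use i r in auto)
        thus "{b + Suc i, b + 2 * r - i} \<in> {D \<in> G. D \<subseteq> U}"
          using i r ab U_eq by auto
      next
        show "disjoint_family_on (\<lambda>i. {b + Suc i, b + 2 * r - i}) {..<u - c}"
          using r unfolding disjoint_family_on_def by auto
      qed
      thus False using extend \<open>c < u\<close> by simp
    qed
    \<comment> \<open>These pairs lie above \<open>{b + r, b + 2 * r}\<close>, hence are missing
      too; \<open>r \<ge> 2\<close> keeps \<open>b + Suc r\<close> below \<open>b + 2 * r\<close>.
      With the empty set and the singletons there are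
      \<open>1 + u + 2 * (c - r + 1) = 3 * c - r + 3\<close> missing sets, and
      \<open>r \<le> c\<close>.\<close>
    define P where "P = (\<lambda>y. {b + r, y}) ` {b+2*r..b+u} \<union> (\<lambda>y. {b + Suc r, y}) ` {b+2*r..b+u}"
    have PN: "P \<subseteq> N"
    proof -
      have "{x, y} \<in> N" if "b + r \<le> x" "b + 2 * r \<le> y" "y \<le> b + u" "x < y" for x y
      proof -
        have "{x, y} \<notin> G" using low[of x y "b + r" "b + 2 * r"] key that r by auto
        thus ?thesis using that ab r unfolding N_def by auto
      qed
      thus ?thesis using r unfolding P_def by auto
    qed
    have i1: "inj_on (\<lambda>y. {b + r, y}) {b+2*r..b+u}"
      by (rule inj_onI) (auto simp: doubleton_eq_iff)
    have i2: "inj_on (\<lambda>y. {b + Suc r, y}) {b+2*r..b+u}"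
      by (rule inj_onI) (auto simp: doubleton_eq_iff)
    have "card P = card ((\<lambda>y. {b + r, y}) ` {b+2*r..b+u}) + card ((\<lambda>y. {b + Suc r, y}) ` {b+2*r..b+u})"
      unfolding P_def using r by (intro card_Un_disjoint) (auto simp: doubleton_eq_iff)
    hence cP: "card P = 2 * (c - r + 1)"
      unfolding card_image[OF i1] card_image[OF i2] using r by simp
    have "insert {} ((\<lambda>x. {x}) ` U) \<inter> P = {}"
    proof -
      have "card D = 2" if "D \<in> P" for D using that r unfolding P_def by auto
      moreover have "card D \<noteq> 2" if "D \<in> insert {} ((\<lambda>x. {x}) ` U)" for D using that by auto
      ultimately show ?thesis by blast
    qed
    hence "card (insert {} ((\<lambda>x. {x}) ` U) \<union> P) = Suc u + card P"
      using card_base finU by (subst card_Un_disjoint) (auto simp: P_def)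
    moreover have "card (insert {} ((\<lambda>x. {x}) ` U) \<union> P) \<le> card N"
      using base PN finN by (intro card_mono) auto
    ultimately have "Suc u + card P \<le> card N" by metis
    moreover obtain d where "c = r + d" using r le_Suc_ex by blast
    ultimately have "2 * c + 3 \<le> card N" using cP r by simp
    thus ?thesis by blast
  qed
qed

section \<open>Structure of compressed families missing few sets\<close>

text \<open>\<open>A\<close> and \<open>D\<close> live in disjoint sets, so the union determines
  both and distinct pairs give distinct members of \<open>M\<close>. This turns a single failure
  into a lower bound on the number of sets outside \<open>F\<close>.\<close>

lemma card_union_pairs_le:
  assumes "finite V" and "K \<subseteq> V" and "E \<inter> V = {}" and "finite E" and "N \<subseteq> Pow E" and M: "finite M"
    and "\<And>A D. A \<subseteq> K \<Longrightarrow> card A = a \<Longrightarrow> D \<in> N \<Longrightarrow> A \<union> D \<in> M"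
  shows "card N * (card K choose a) \<le> card M"
proof -
  define S where "S = {A. A \<subseteq> K \<and> card A = a} \<times> N"
  have finK: "finite K" using assms finite_subset by blast
  have "inj_on (\<lambda>(A, D). A \<union> D) S"
  proof (rule inj_onI)
    fix x y assume x: "x \<in> S" and y: "y \<in> S" and eq: "(\<lambda>(A, D). A \<union> D) x = (\<lambda>(A, D). A \<union> D) y"
    obtain A D A' D' where xy: "x = (A, D)" "y = (A', D')" by fastforce
    have inc: "A \<subseteq> V" "A' \<subseteq> V" "D \<subseteq> E" "D' \<subseteq> E"
      using x y assms(2,5) unfolding xy S_def by auto
    have "A \<union> D = A' \<union> D'" using eq xy by simp
    hence "A = A'" "D = D'" using inc assms(3) by blast+
    thus "x = y" using xy by simp
  qed
  moreover have "(\<lambda>(A, D). A \<union> D) ` S \<subseteq> M"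
  proof
    fix z assume "z \<in> (\<lambda>(A, D). A \<union> D) ` S"
    then obtain A D where "z = A \<union> D" "A \<subseteq> K" "card A = a" "D \<in> N" unfolding S_def by auto
    thus "z \<in> M" using assms(7) by simp
  qed
  ultimately have "card S \<le> card M" using M by (intro card_inj_on_le)
  moreover have "card S = (card K choose a) * card N"
    unfolding S_def card_cartesian_product using n_subsets[OF finK] by simp
  ultimately show ?thesis by (simp add: mult.commute)
qed

text \<open>\<open>few1\<close> puts the small m-sets into \<open>F\<close>, and \<open>few2\<close>
  leaves at most \<open>2 * c + 2\<close> tail sets outside \<open>G\<close>, as the dichotomy
  requires. The value of \<open>r\<close> reserves \<open>(m - 1) * L\<close> points for completing
  at most \<open>L\<close> tail sets and \<open>m\<close> more for points that a further member
  \<open>X\<close> may occupy.\<close>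

lemma (in compressed_family) few_missing_sets_structure:
  fixes m c s L :: nat
  defines "r \<equiv> (m - 1) * L + m"
  assumes n: "n = m * s + c" and m: "m \<ge> 1" and c: "c \<ge> 1" and L: "2 * c + 1 \<le> L" and s: "L + 2 \<le> s"
    and nm: "\<not> has_matching s F"
    and few1: "card (Pow {1..n} - F) < L * ((s - L) choose (m - 1))"
    and few2: "card (Pow {1..n} - F) < (2 * c + 3) * ((n - (L + r + m - 1)) choose (m - 1))"
  shows "(\<forall>X\<in>F. 2 * m \<le> card X + card (X \<inter> {1..n-(2*c+1)}))
     \<or> c = 1 \<and> (\<forall>X\<in>F. m \<le> card (X \<inter> {1..n-2}))"
proof -
  define E where "E = {n-L<..n}"
  \<comment> \<open>Every (m-1)-subset of \<open>{1..r}\<close> lies below \<open>A0\<close>, and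
    every one of \<open>{r+m..n-L}\<close> lies above it. A tail set accepted with \<open>A0\<close>
    is thus accepted with all of the former, and one rejected with \<open>A0\<close> is rejected
    with all of the latter.\<close>
  define A0 where "A0 = {r<..r+(m-1)}"
  define G where "G = {D. D \<subseteq> E \<and> A0 \<union> D \<in> F}"
  obtain a where a: "m = Suc a" using m by (cases m) auto
  have "a * (L + 2) \<le> a * s" using s by (intro mult_le_mono2)
  hence aL: "a * L + a * 2 \<le> a * s" by (simp add: algebra_simps)
  have n': "n = s + a * s + c" using n a by simp
  have r': "r = a * L + a + 1" unfolding r_def a by simp
  have rn: "r + m - 1 \<le> n - L" using aL s n' r' a by linarith
  have rn': "r \<le> n - L" using rn m by linarith
  have Ln: "L \<le> n" "s \<le> n" using s n' by linarith+
  have cA0: "card A0 = m - 1" unfolding A0_def by simp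
  have finF: "finite (Pow {1..n} - F)" by simp

  \<comment> \<open>If \<open>insert x B\<close> were missing, so would be
    \<open>A \<union> {y}\<close> for every \<open>y\<close> in the tail and every (m-1)-set
    \<open>A\<close> in \<open>{n-s<..n-L}\<close>, since lowering \<open>A\<close> to
    \<open>B\<close> and then \<open>y\<close> to \<open>x\<close> leads to
    \<open>insert x B\<close>. That is more than \<open>few1\<close> allows.\<close>
  have generic: "insert x B \<in> F" if B: "B \<subseteq> {1..n-s}" "card B = m - 1" and x: "x \<in> {1..n-L} - B" for B x
  proof (rule ccontr)
    assume no: "insert x B \<notin> F"
    have miss: "A \<union> {y} \<in> Pow {1..n} - F" if A: "A \<subseteq> {n-s<..n-L}" "card A = m - 1" and y: "y \<in> E" for A y
    proof -
      have "A \<union> {y} \<notin> F"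
      proof
        assume "A \<union> {y} \<in> F"
        hence "{y} \<union> A \<in> F" by (simp add: Un_commute)
        hence "{y} \<union> B \<in> F"
        proof (rule replace_by_smaller[rotated])
          show "finite A" "finite B" using A B finite_subset by blast+
          show "card B = card A" using A B by simp
          show "A \<inter> {y} = {}" using A y unfolding E_def by auto
          show "B \<inter> {y} = {}" using B y s unfolding E_def by auto
          show "b < a" if "a \<in> A" "b \<in> B" for a b
          proof -
            have "n - s < a" "b \<le> n - s" using that A B by auto
            thus ?thesis by simp
          qed
          show "0 \<notin> B" using B by auto
        qed
        hence "insert x (({y} \<union> B) - {y}) \<in> F"
        proof (rule swap)
          show "x \<notin> {y} \<union> B" using x y unfolding E_def by auto
          show "1 \<le> x" "x < y" using x y unfolding E_def by auto
        qed simp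
        moreover have "y \<notin> B" using B y s unfolding E_def by auto
        ultimately show False using no by simp
      qed
      moreover have "A \<union> {y} \<subseteq> {1..n}" using A y unfolding E_def by auto
      ultimately show ?thesis by blast
    qed
    have "card ((\<lambda>y. {y}) ` E) * (card {n-s<..n-L} choose (m - 1)) \<le> card (Pow {1..n} - F)"
    proof (rule card_union_pairs_le[where V = "{n-s<..n-L}" and E = E])
      show "E \<inter> {n-s<..n-L} = {}" unfolding E_def by auto
      show "A \<union> D \<in> Pow {1..n} - F"
        if "A \<subseteq> {n-s<..n-L}" "card A = m - 1" "D \<in> (\<lambda>y. {y}) ` E" for A D
        using miss that by blast
    qed (auto simp: E_def)
    moreover have "card ((\<lambda>y. {y}) ` E) = L" using Ln by (simp add: card_image E_def)
    moreover have "card {n-s<..n-L} = s - L" using Ln s by simp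
    ultimately show False using few1 by simp
  qed

  have fill: "A \<union> D \<in> F" if D: "D \<in> G" and A: "A \<subseteq> {1..r}" "card A = m - 1" for A D
  proof -
    have "D \<union> A0 \<in> F" using D unfolding G_def by (simp add: Un_commute)
    moreover have "b < a" if "a \<in> A0" "b \<in> A" for a b
    proof -
      have "r < a" "b \<le> r" using that A unfolding A0_def by auto
      thus ?thesis by simp
    qed
    moreover have "A0 \<inter> D = {}" "A \<inter> D = {}"
    proof -
      have "D \<subseteq> {n-L<..}" using D unfolding G_def E_def by auto
      moreover have "A0 \<subseteq> {..n-L}" "A \<subseteq> {..n-L}" using rn rn' A m unfolding A0_def by auto
      ultimately show "A0 \<inter> D = {}" "A \<inter> D = {}" by fastforce+
    qed
    moreover have "finite A" "0 \<notin> A" using A finite_subset by auto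
    ultimately have "D \<union> A \<in> F"
      by (intro replace_by_smaller[of A0 D A]) (auto simp: A0_def A)
    thus ?thesis by (simp add: Un_commute)
  qed

  define N where "N = Pow {n-L<..(n-L)+L} - G"
  have E_eq: "E = {n-L<..(n-L)+L}" using Ln unfolding E_def by simp
  have N_eq: "N = Pow E - G" unfolding N_def E_eq ..

  have miss: "A \<union> D \<in> Pow {1..n} - F" if A: "A \<subseteq> {r+m..n-L}" "card A = m - 1" and D: "D \<in> N" for A D
  proof -
    have "A \<union> D \<notin> F"
    proof
      assume "A \<union> D \<in> F"
      hence "D \<union> A \<in> F" by (simp add: Un_commute)
      moreover have "b < a" if "a \<in> A" "b \<in> A0" for a b
      proof -
        have "r + m \<le> a" "b \<le> r + (m - 1)" using that A unfolding A0_def by auto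
        thus ?thesis using m by linarith
      qed
      moreover have "A0 \<inter> D = {}" "A \<inter> D = {}"
      proof -
        have "D \<subseteq> {n-L<..}" using D unfolding N_eq E_def by auto
        moreover have "A0 \<subseteq> {..n-L}" "A \<subseteq> {..n-L}" using rn A m unfolding A0_def by auto
        ultimately show "A0 \<inter> D = {}" "A \<inter> D = {}" by fastforce+
      qed
      moreover have "finite A" using A finite_subset by auto
      moreover have "0 \<notin> A0" unfolding A0_def by simp
      ultimately have "D \<union> A0 \<in> F"
        using cA0 A by (intro replace_by_smaller[of A D A0]) (auto simp: A0_def)
      thus False using D unfolding N_eq G_def by (simp add: Un_commute)
    qed
    moreover have "A \<union> D \<subseteq> {1..n}" using A D m unfolding N_eq E_def by fastforce
    ultimately show ?thesis by blast
  qed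
  have cN: "card N < 2 * c + 3"
  proof (rule ccontr)
    assume "\<not> card N < 2 * c + 3"
    hence "(2 * c + 3) * (card {r+m..n-L} choose (m - 1)) \<le> card N * (card {r+m..n-L} choose (m - 1))"
      by (intro mult_le_mono1) simp
    also have "card N * (card {r+m..n-L} choose (m - 1)) \<le> card (Pow {1..n} - F)"
    proof (rule card_union_pairs_le[where V = "{r+m..n-L}" and E = E])
      show "E \<inter> {r+m..n-L} = {}" unfolding E_def by auto
      show "N \<subseteq> Pow E" unfolding N_eq by auto
    qed (use miss in \<open>auto simp: E_def\<close>)
    finally have "(2 * c + 3) * (card {r+m..n-L} choose (m - 1)) \<le> card (Pow {1..n} - F)" .
    moreover have "card {r+m..n-L} = n - (L + r + m - 1)" using rn m Ln by simp
    ultimately show False using few2 by simp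
  qed

  have Gup: "B \<in> G" if "A \<in> G" "A \<subseteq> B" "B \<subseteq> E" for A B
  proof -
    have "A0 \<union> B \<in> F"
    proof (rule up)
      show "A0 \<union> A \<in> F" using that unfolding G_def by simp
      have "A0 \<subseteq> {1..n}" using rn m unfolding A0_def by auto
      thus "A0 \<union> B \<subseteq> {1..n}" using that unfolding E_def by auto
    qed (use that in auto)
    thus ?thesis using that unfolding G_def by simp
  qed
  have Gswap: "insert y (A - {x}) \<in> G" if "A \<in> G" "x \<in> A" "y \<notin> A" "n - L < y" "y < x" for A x y
  proof -
    have x: "x \<in> E" using that unfolding G_def by auto
    have y: "y \<in> E" using that x unfolding E_def by auto
    have xy: "x \<notin> A0" "y \<notin> A0" using x y rn m unfolding A0_def E_def by auto
    have "insert y ((A0 \<union> A) - {x}) \<in> F"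
      by (rule swap) (use that xy in \<open>auto simp: G_def\<close>)
    moreover have "insert y ((A0 \<union> A) - {x}) = A0 \<union> insert y (A - {x})" using xy by auto
    ultimately show ?thesis using that y unfolding G_def by auto
  qed

  \<comment> \<open>The room is exactly sufficient: with \<open>k = s - (L - c)\<close> generic
    sets, \<open>n = m * s + c\<close> gives
    \<open>n - L = m * k + (m - 1) * (L - c)\<close>.\<close>
  have no_tail: "\<not> has_matching (L - c) G"
  proof
    assume "has_matching (L - c) G"
    then obtain g where g: "\<And>i. i < L - c \<Longrightarrow> g i \<in> G" "disjoint_family_on g {..<L-c}"
      unfolding has_matching_def by blast
    define k where "k = s - (L - c)"
    have sk: "s = (L - c) + k" using s unfolding k_def by simp
    have "\<exists>f. (\<forall>i<(L-c)+k. f i \<in> F \<and> f i \<inter> {} = {}) \<and> disjoint_family_on f {..<(L-c)+k}"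
    proof (rule completion[where s = s and L = L and r = r and m = m, OF generic fill[OF g(1)]])
      show "g i \<subseteq> {n-L<..n}" if "i < L - c" for i using g(1)[OF that] unfolding G_def E_def by auto
      have "(m - 1) * (L - c) \<le> (m - 1) * L" by (intro mult_le_mono2) simp
      thus "(m - 1) * (L - c) + card ({} \<inter> {1..r}) \<le> r"
        unfolding r_def Int_empty_left card.empty by linarith
      have "m * (q + k) = m * k + (m - 1) * q + q" for q
        unfolding a by (simp add: algebra_simps)
      from this[of "L - c"] have "m * s = m * k + (m - 1) * (L - c) + (L - c)"
        unfolding sk .
      thus "m * k + (m - 1) * (L - c) + card ({} \<inter> {1..n-L}) \<le> n - L"
        using n L by simp
    qed (use g rn m s Ln sk in auto)
    thus False using nm unfolding has_matching_def sk by blast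
  qed

  \<comment> \<open>\<open>S\<close> supplies singletons and \<open>T\<close> pairs of the tail,
    \<open>q\<close> sets in all; together with \<open>X\<close> and \<open>s - 1 - q\<close>
    generic sets they would form \<open>s\<close> disjoint members. \<open>large\<close> says that
    the points below the tail suffice, \<open>small\<close> that at least \<open>s - L\<close>
    generic sets remain to take up the points above \<open>n - s\<close>.\<close>
  have no_completion: False
    if X: "X \<in> F" "card (X \<inter> {1..n-L}) \<le> m - 1"
      and S: "S \<subseteq> E" "\<And>x. x \<in> S \<Longrightarrow> {x} \<in> G" "S \<inter> X = {}"
      and T: "T \<subseteq> E" "\<And>x y. x \<in> T \<Longrightarrow> y \<in> T \<Longrightarrow> x \<noteq> y \<Longrightarrow> {x, y} \<in> G" "T \<inter> X = {}"
      and ST: "S \<inter> T = {}"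
      and small: "card S + card T div 2 + 1 \<le> L"
      and large: "L + card (X \<inter> {1..n-L}) \<le> c + m + card S + card T div 2"
    for X S T
  proof -
    define v where "v = card S"
    define p where "p = card T div 2"
    have fin: "finite S" "finite T" using S(1) T(1) finite_subset unfolding E_def by auto
    obtain g1 where g1: "\<And>i. i < v \<Longrightarrow> g1 i \<subseteq> S" "\<And>i. i < v \<Longrightarrow> card (g1 i) = 1" "disjoint_family_on g1 {..<v}"
      using disjoint_equal_parts[OF fin(1), of 1 v] unfolding v_def by auto
    obtain g2 where g2: "\<And>i. i < p \<Longrightarrow> g2 i \<subseteq> T" "\<And>i. i < p \<Longrightarrow> card (g2 i) = 2" "disjoint_family_on g2 {..<p}"
      using disjoint_equal_parts[OF fin(2), of 2 p] unfolding p_def by auto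
    define g where "g i = (if i < v then g1 i else g2 (i - v))" for i
    have gG: "g i \<in> G" "g i \<inter> X = {}" if "i < v + p" for i
    proof -
      have "g i \<in> G \<and> g i \<inter> X = {}"
      proof (cases "i < v")
        case True
        obtain x where x: "g1 i = {x}" using g1(2)[OF True] by (auto simp: card_1_singleton_iff)
        have "x \<in> S" using g1(1)[OF True] x by simp
        thus ?thesis using True x S(2)[of x] S(3) unfolding g_def by auto
      next
        case False
        hence i: "i - v < p" using that by simp
        obtain x y where xy: "g2 (i - v) = {x, y}" "x \<noteq> y" using g2(2)[OF i] by (auto simp: card_2_iff)
        have "x \<in> T" "y \<in> T" using g2(1)[OF i] xy by simp_all
        thus ?thesis using False xy T(2)[of x y] T(3) unfolding g_def by auto
      qed
      thus "g i \<in> G" "g i \<inter> X = {}" by auto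
    qed
    have gd: "disjoint_family_on g {..<v+p}"
    proof (rule disjoint_family_onI_less)
      fix i j assume ij: "i < j" "j < v + p"
      consider "j < v" | "i < v" "\<not> j < v" | "\<not> i < v" "\<not> j < v" using ij by linarith
      thus "g i \<inter> g j = {}"
      proof cases
        case 1
        thus ?thesis using disjoint_family_onD[OF g1(3), of i j] ij unfolding g_def by simp
      next
        case 2
        hence "j - v < p" using ij by simp
        thus ?thesis using 2 g1(1)[of i] g2(1)[of "j - v"] ST unfolding g_def by auto
      next
        case 3
        hence "i - v < p" "j - v < p" "i - v \<noteq> j - v" using ij by auto
        thus ?thesis using 3 disjoint_family_onD[OF g2(3), of "i - v" "j - v"] unfolding g_def by simp
      qed
    qed
    define q where "q = v + p"
    define k where "k = s - 1 - q"
    have qL: "q + 1 \<le> L" using small unfolding q_def v_def p_def by simp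
    have sk: "s = Suc (q + k)" using qL s unfolding k_def by simp
    have "X \<inter> {1..r} \<subseteq> X \<inter> {1..n-L}" using rn m by auto
    hence "card (X \<inter> {1..r}) \<le> card (X \<inter> {1..n-L})" by (intro card_mono) auto
    hence Xr: "card (X \<inter> {1..r}) \<le> m" using X(2) by simp
    have "\<exists>f. (\<forall>i<q+k. f i \<in> F \<and> f i \<inter> X = {}) \<and> disjoint_family_on f {..<q+k}"
    proof (rule completion[where s = s and L = L and r = r and m = m, OF generic fill])
      show "g i \<in> G" "g i \<inter> X = {}" if "i < q" for i using gG that unfolding q_def by auto
      show "g i \<subseteq> {n-L<..n}" if "i < q" for i using gG(1) that unfolding q_def G_def E_def by auto
      show "disjoint_family_on g {..<q}" using gd unfolding q_def .
      have "(m - 1) * q \<le> (m - 1) * L" using qL by (intro mult_le_mono2) simp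
      thus "(m - 1) * q + card (X \<inter> {1..r}) \<le> r" using Xr unfolding r_def by linarith
      have "m * s = m * k + (m - 1) * q + q + m"
        unfolding sk a by (simp add: algebra_simps)
      thus "m * k + (m - 1) * q + card (X \<inter> {1..n-L}) \<le> n - L"
        using n large unfolding q_def v_def p_def by linarith
      show "r \<le> n - L" by (rule rn')
      show "s \<le> k + L" using sk qL by simp
    qed (use s Ln m in auto)
    then obtain f where f: "\<And>i. i < q + k \<Longrightarrow> f i \<in> F \<and> f i \<inter> X = {}" "disjoint_family_on f {..<q+k}"
      by blast
    define h where "h i = (if i < q + k then f i else X)" for i
    have "h i \<in> F" for i using f(1)[of i] X(1) unfolding h_def by simp
    moreover have "disjoint_family_on h {..<s}"
    proof (rule disjoint_family_onI_less)
      fix i j assume ij: "i < j" "j < s"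
      thus "h i \<inter> h j = {}"
        using f(1)[of i] disjoint_family_onD[OF f(2), of i j] sk unfolding h_def by auto
    qed
    ultimately show False using nm unfolding has_matching_def by blast
  qed

  have "2 * c + 3 \<le> card N \<or> N = insert {} ((\<lambda>x. {x}) ` {n-L+L-(2*c+1)<..n-L+L})
     \<or> c = 1 \<and> N = Pow {n-L+L-2<..n-L+L}"
    unfolding N_def
  proof (rule tail_family_dichotomy)
    show "G \<subseteq> Pow {n-L<..n-L+L}" using E_eq unfolding G_def by auto
    show "B \<in> G" if "A \<in> G" "A \<subseteq> B" "B \<subseteq> {n-L<..n-L+L}" for A B
      using Gup that E_eq by simp
  qed (use Gswap no_tail c L in blast)+
  hence "N = insert {} ((\<lambda>x. {x}) ` {n-(2*c+1)<..n}) \<or> c = 1 \<and> N = Pow {n-2<..n}"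
    using cN Ln by simp
  thus ?thesis
  proof
    assume N: "N = insert {} ((\<lambda>x. {x}) ` {n-(2*c+1)<..n})"
    have G1: "{x} \<in> G" if "x \<in> E" "x \<le> n - (2 * c + 1)" for x
    proof -
      have "{x} \<notin> N" using that unfolding N by auto
      thus ?thesis using that unfolding N_eq by auto
    qed
    have G2: "{x, y} \<in> G" if "x \<in> E" "y \<in> E" "x \<noteq> y" for x y
    proof -
      have "{x, y} \<notin> N" using that unfolding N by auto
      thus ?thesis using that unfolding N_eq by auto
    qed
    have "2 * m \<le> card X + card (X \<inter> {1..n-(2*c+1)})" if X: "X \<in> F" for X
    proof (rule ccontr)
      assume less: "\<not> 2 * m \<le> card X + card (X \<inter> {1..n-(2*c+1)})"
      define T where "T = {n-(2*c+1)<..n}"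
      define H where "H = {n-L<..n-(2*c+1)}"
      have Xn: "X \<subseteq> {1..n}" using X sub by auto
      have finX: "finite X" using Xn finite_subset by blast
      have TH: "T \<subseteq> E" "H \<subseteq> E" "T \<inter> H = {}" using L unfolding T_def H_def E_def by auto
      have "X = (X \<inter> {1..n-(2*c+1)}) \<union> (X \<inter> T)" using Xn unfolding T_def by fastforce
      hence c1: "card X = card (X \<inter> {1..n-(2*c+1)}) + card (X \<inter> T)"
        using finX by (subst card_Un_disjoint[symmetric]) (auto simp: T_def)
      have "X \<inter> {1..n-(2*c+1)} = (X \<inter> {1..n-L}) \<union> (X \<inter> H)" using Xn L unfolding H_def by auto
      hence c2: "card (X \<inter> {1..n-(2*c+1)}) = card (X \<inter> {1..n-L}) + card (X \<inter> H)"
        using finX by (subst card_Un_disjoint[symmetric]) (auto simp: H_def)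
      have c3: "card (T - X) + card (X \<inter> T) = 2 * c + 1"
      proof -
        have "card T = 2 * c + 1" using L Ln unfolding T_def by simp
        thus ?thesis using card_Int_Diff[of T X] by (simp add: T_def Int_commute)
      qed
      have c4: "card (H - X) + card (X \<inter> H) = L - (2 * c + 1)"
      proof -
        have "card H = L - (2 * c + 1)" using L Ln unfolding H_def by simp
        thus ?thesis using card_Int_Diff[of H X] by (simp add: H_def Int_commute)
      qed
      \<comment> \<open>Let \<open>t = card (X \<inter> T)\<close>. The failed weight condition
        bounds \<open>card (X \<inter> {1..n-(2*c+1)})\<close> by
        \<open>(2 * m - 1 - t) div 2\<close>, and \<open>large\<close> asks for the bound
        \<open>m - c - 1 + (2 * c + 1 - t) div 2\<close>. These agree, since
        \<open>2 * m - 1\<close> and \<open>2 * c + 1\<close> differ by an even number.\<close>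
      show False
      proof (rule no_completion[OF X, of "H - X" "T - X"])
        show "card (X \<inter> {1..n-L}) \<le> m - 1" using less c1 c2 by linarith
        show "{x} \<in> G" if "x \<in> H - X" for x using G1[of x] that TH unfolding H_def by auto
        show "{x, y} \<in> G" if "x \<in> T - X" "y \<in> T - X" "x \<noteq> y" for x y
          using G2[of x y] that TH by auto
        show "card (H - X) + card (T - X) div 2 + 1 \<le> L" using c3 c4 L c by linarith
        show "L + card (X \<inter> {1..n-L}) \<le> c + m + card (H - X) + card (T - X) div 2"
          using c1 c2 c3 c4 less L by linarith
      qed (use TH in blast)+
    qed
    thus ?thesis by blast
  next
    assume "c = 1 \<and> N = Pow {n-2<..n}"
    hence c1: "c = 1" and N: "N = Pow {n-2<..n}" by auto
    have G1: "{x} \<in> G" if "x \<in> E" "x \<le> n - 2" for x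
    proof -
      have "{x} \<notin> N" using that unfolding N by auto
      thus ?thesis using that unfolding N_eq by auto
    qed
    have "m \<le> card (X \<inter> {1..n-2})" if X: "X \<in> F" for X
    proof (rule ccontr)
      assume less: "\<not> m \<le> card (X \<inter> {1..n-2})"
      define H where "H = {n-L<..n-2}"
      have Xn: "X \<subseteq> {1..n}" using X sub by auto
      have finX: "finite X" using Xn finite_subset by blast
      have HE: "H \<subseteq> E" unfolding H_def E_def by auto
      have "X \<inter> {1..n-2} = (X \<inter> {1..n-L}) \<union> (X \<inter> H)" using Xn L c1 unfolding H_def by auto
      hence c2: "card (X \<inter> {1..n-2}) = card (X \<inter> {1..n-L}) + card (X \<inter> H)"
        using finX by (subst card_Un_disjoint[symmetric]) (auto simp: H_def)
      have c4: "card (H - X) + card (X \<inter> H) = L - 2"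
      proof -
        have "card H = L - 2" using L Ln c1 unfolding H_def by simp
        thus ?thesis using card_Int_Diff[of H X] by (simp add: H_def Int_commute)
      qed
      \<comment> \<open>No subset of the last two points belongs to \<open>G\<close>, so only the
        singletons in \<open>H\<close> are used. Then \<open>large\<close> amounts to
        \<open>card (X \<inter> {1..n-2}) \<le> m - 1\<close>.\<close>
      show False
      proof (rule no_completion[OF X, of "H - X" "{}"])
        show "card (X \<inter> {1..n-L}) \<le> m - 1" using less c2 by linarith
        show "{x} \<in> G" if "x \<in> H - X" for x using G1[of x] that HE unfolding H_def by auto
        show "card (H - X) + card ({}::nat set) div 2 + 1 \<le> L" using c4 L c1 by simp
        show "L + card (X \<inter> {1..n-L}) \<le> c + m + card (H - X) + card ({}::nat set) div 2"
          using c1 c2 c4 less L by simp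
      qed (use HE in blast)+
    qed
    thus ?thesis using c1 by blast
  qed
qed

section \<open>Compression, the empty set, and shifting\<close>

text \<open>New sets contain \<open>y\<close>, so a matching has at most one of them. Its original
  \<open>A\<close> takes its place; if another member \<open>f j\<close> occupies \<open>x\<close>,
  then \<open>f j\<close> gives up \<open>x\<close> for the released \<open>y\<close>.\<close>

lemma has_matching_compression:
  assumes xy: "x \<noteq> y"
    and F': "F' = (\<lambda>C. if x \<in> C \<and> y \<notin> C \<and> insert y (C - {x}) \<notin> F then insert y (C - {x}) else C) ` F"
    and match: "has_matching k F'"
  shows "has_matching k F"
proof -
  obtain f where f: "\<And>i. i < k \<Longrightarrow> f i \<in> F'" and d: "disjoint_family_on f {..<k}"
    using match unfolding has_matching_def by blast
  have dj: "f i \<inter> f j = {}" if "i < k" "j < k" "i \<noteq> j" for i j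
    using disjoint_family_onD[OF d, of i j] that by simp
  show ?thesis
  proof (cases "\<forall>i<k. f i \<in> F")
    case True
    thus ?thesis using d unfolding has_matching_def by blast
  next
    case False
    then obtain i where i: "i < k" "f i \<notin> F" by blast
    have new: "\<exists>A\<in>F. x \<in> A \<and> y \<notin> A \<and> f j = insert y (A - {x})" if "j < k" "f j \<notin> F" for j
      using f[OF that(1)] that(2) unfolding F' by (auto split: if_splits)
    obtain A where A: "A \<in> F" "x \<in> A" "y \<notin> A" "f i = insert y (A - {x})"
      using new[OF i] by blast
    have y_notin: "y \<notin> f j" if "j < k" "j \<noteq> i" for j
      using dj[OF that(1) i(1) that(2)] A(4) by auto
    have old: "f j \<in> F" if "j < k" "j \<noteq> i" for j
      using new[OF that(1)] y_notin[OF that] by blast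
    have Aj: "(A - {x}) \<inter> f j = {}" if "j < k" "j \<noteq> i" for j
      using dj[OF that(1) i(1) that(2)] A(4) by auto
    show ?thesis
    proof (cases "\<exists>j<k. j \<noteq> i \<and> x \<in> f j")
      case False
      define h where "h = f(i := A)"
      have "h j \<in> F" if "j < k" for j using old[OF that] A(1) unfolding h_def by simp
      moreover have Aj': "A \<inter> f j = {}" if "j < k" "j \<noteq> i" for j
        using Aj[OF that] False that by blast
      have "disjoint_family_on h {..<k}"
      proof (rule disjoint_family_onI_less)
        fix a b assume ab: "a < b" "b < k"
        thus "h a \<inter> h b = {}"
          using dj[of a b] Aj'[of a] Aj'[of b] unfolding h_def by (auto simp: Int_commute)
      qed
      ultimately show ?thesis unfolding has_matching_def by blast
    next
      case True
      then obtain j where j: "j < k" "j \<noteq> i" "x \<in> f j" by blast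
      \<comment> \<open>\<open>f j\<close> contains \<open>x\<close> and not \<open>y\<close>, so
        the compression left it in place; the only possible reason is that its swapped version was
        already in \<open>F\<close>.\<close>
      have moved: "insert y (f j - {x}) \<in> F"
      proof -
        obtain C where C: "C \<in> F"
          "f j = (if x \<in> C \<and> y \<notin> C \<and> insert y (C - {x}) \<notin> F then insert y (C - {x}) else C)"
          using f[OF j(1)] unfolding F' by blast
        thus ?thesis using j(3) y_notin[OF j(1,2)] xy by (auto split: if_splits)
      qed
      define h where "h = f(i := A, j := insert y (f j - {x}))"
      have "h l \<in> F" if "l < k" for l
        using old[OF that] A(1) moved unfolding h_def by simp
      moreover have xl: "x \<notin> f l" if "l < k" "l \<noteq> j" for l
        using dj[OF that(1) j(1) that(2)] j(3) by blast
      have A_l: "A \<inter> f l = {}" if "l < k" "l \<noteq> i" "l \<noteq> j" for l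
        using Aj[OF that(1,2)] xl[OF that(1,3)] by blast
      have j_l: "insert y (f j - {x}) \<inter> f l = {}" if "l < k" "l \<noteq> i" "l \<noteq> j" for l
        using dj[OF that(1) j(1) that(3)] y_notin[OF that(1,2)] by blast
      have A_j: "A \<inter> insert y (f j - {x}) = {}"
        using Aj[OF j(1,2)] A(3) by blast
      have "h a \<inter> h b = {}" if "a < k" "b < k" "a \<noteq> b" for a b
      proof -
        consider "a = i" "b = j" | "a = j" "b = i" | "a = i" "b \<noteq> j" | "a = j" "b \<noteq> i"
          | "b = i" "a \<noteq> j" | "b = j" "a \<noteq> i" | "a \<noteq> i" "a \<noteq> j" "b \<noteq> i" "b \<noteq> j"
          by blast
        thus ?thesis
        proof cases
          case 1
          thus ?thesis using A_j j(2) unfolding h_def by simp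
        next
          case 2
          thus ?thesis using A_j j(2) unfolding h_def by (simp add: Int_commute)
        next
          case 3
          thus ?thesis using A_l[of b] that j(2) unfolding h_def by simp
        next
          case 4
          thus ?thesis using j_l[of b] that j(2) unfolding h_def by simp
        next
          case 5
          thus ?thesis using A_l[of a] that j(2) unfolding h_def by (simp add: Int_commute)
        next
          case 6
          hence "insert y (f j - {x}) \<inter> f a = {}" using j_l[of a] that by blast
          thus ?thesis using 6 that unfolding h_def by (simp add: Int_commute)
        next
          case 7
          thus ?thesis using dj[of a b] that unfolding h_def by simp
        qed
      qed
      hence "disjoint_family_on h {..<k}" by (intro disjoint_family_onI_less) simp
      ultimately show ?thesis unfolding has_matching_def by blast
    qed
  qed
qed

text \<open>Choose a family with the least total sum of elements among those meeting the other
  requirements. A failing swap would yield a compression that preserves them all and has a smaller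
  sum.\<close>

lemma exists_swap_closed_family:
  fixes F :: "nat set set"
  assumes "F \<subseteq> Pow {1..n}" "{} \<notin> F" "\<not> has_matching s F"
  shows "\<exists>F'. F' \<subseteq> Pow {1..n} \<and> {} \<notin> F' \<and> \<not> has_matching s F' \<and> card F' = card F \<and>
    (\<forall>A x y. A \<in> F' \<longrightarrow> x \<in> A \<longrightarrow> y \<notin> A \<longrightarrow> 1 \<le> y \<longrightarrow> y < x \<longrightarrow> insert y (A - {x}) \<in> F')"
proof -
  define P where "P F' \<longleftrightarrow> F' \<subseteq> Pow {1..n} \<and> {} \<notin> F' \<and> \<not> has_matching s F' \<and> card F' = card F" for F'
  define w where "w F' = (\<Sum>A\<in>F'. \<Sum>A)" for F' :: "nat set set"
  have "P F" using assms unfolding P_def by simp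
  then obtain H where H: "P H" and least: "\<And>H'. P H' \<Longrightarrow> w H \<le> w H'"
    using ex_has_least_nat[of P F w] by blast
  have finH: "finite H" using H finite_subset unfolding P_def by (meson finite_Pow_iff finite_atLeastAtMost)
  have finA: "finite A" if "A \<in> H" for A
    using H that finite_subset unfolding P_def by blast
  have "insert y (A - {x}) \<in> H" if A: "A \<in> H" "x \<in> A" "y \<notin> A" "1 \<le> y" "y < x" for A x y
  proof (rule ccontr)
    assume no: "insert y (A - {x}) \<notin> H"
    define \<phi> where "\<phi> C = (if x \<in> C \<and> y \<notin> C \<and> insert y (C - {x}) \<notin> H then insert y (C - {x}) else C)" for C
    \<comment> \<open>A moved image lies outside \<open>H\<close>, so it cannot coincide with an
      unmoved set; \<open>E\<close> deals with two moved sets.\<close>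
    have inj: "inj_on \<phi> H"
    proof (rule inj_onI)
      fix C D assume CD: "C \<in> H" "D \<in> H" "\<phi> C = \<phi> D"
      have E: "C = D" if "x \<in> C" "y \<notin> C" "x \<in> D" "y \<notin> D" "insert y (C - {x}) = insert y (D - {x})"
      proof -
        have "C - {x} = D - {x}" using that insert_ident[of y "C - {x}" "D - {x}"] by simp
        thus ?thesis using that(1,3) insert_Diff by metis
      qed
      show "C = D" using CD E unfolding \<phi>_def by (auto split: if_splits)
    qed
    have sum_le: "\<Sum>(\<phi> C) \<le> \<Sum>C" if "C \<in> H" for C
    proof (cases "x \<in> C \<and> y \<notin> C")
      case True
      have "\<Sum>(insert y (C - {x})) = y + \<Sum>(C - {x})" using finA[OF that] True by (simp add: A)
      moreover have "\<Sum>C = x + \<Sum>(C - {x})" using sum.remove[OF finA[OF that], of x "\<lambda>z. z"] True by blast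
      ultimately show ?thesis using A(5) unfolding \<phi>_def by simp
    qed (auto simp: \<phi>_def)
    have sum_less: "\<Sum>(\<phi> A) < \<Sum>A"
    proof -
      have "\<Sum>(insert y (A - {x})) = y + \<Sum>(A - {x})" using finA[OF A(1)] A by simp
      moreover have "\<Sum>A = x + \<Sum>(A - {x})" using sum.remove[OF finA[OF A(1)], of x "\<lambda>z. z"] A by blast
      ultimately show ?thesis using A no unfolding \<phi>_def by simp
    qed
    have "w (\<phi> ` H) = (\<Sum>C\<in>H. \<Sum>(\<phi> C))" unfolding w_def by (simp add: sum.reindex[OF inj])
    also have "\<dots> < w H" unfolding w_def
      using sum_less sum_le A(1) finH by (intro sum_strict_mono_ex1) auto
    finally have "w (\<phi> ` H) < w H" .
    moreover have "P (\<phi> ` H)"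
      unfolding P_def
    proof (intro conjI)
      show "\<phi> ` H \<subseteq> Pow {1..n}"
      proof
        fix B assume "B \<in> \<phi> ` H"
        then obtain C where C: "C \<in> H" "B = \<phi> C" by blast
        have "C \<subseteq> {1..n}" "A \<subseteq> {1..n}" using H C A unfolding P_def by auto
        moreover from this have "y \<in> {1..n}" using A by force
        ultimately show "B \<in> Pow {1..n}" using C unfolding \<phi>_def by auto
      qed
      have "{} \<notin> H" using H unfolding P_def by simp
      thus "{} \<notin> \<phi> ` H" unfolding \<phi>_def by auto
      show "\<not> has_matching s (\<phi> ` H)"
        using has_matching_compression[of x y "\<phi> ` H" H s] H A(5) unfolding P_def \<phi>_def by blast
      show "card (\<phi> ` H) = card F" using H card_image[OF inj] unfolding P_def by simp
    qed
    ultimately show False using least[of "\<phi> ` H"] by simp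
  qed
  thus ?thesis using H unfolding P_def by blast
qed

text \<open>The empty set may occur only once in a matching, so a family containing it wastes a slot:
  trading it for two new intersecting sets gives a larger family.\<close>

lemma empty_set_extend:
  assumes V: "finite V" and F: "F \<subseteq> Pow V" and e: "{} \<in> F"
    and no: "\<And>M. M \<subseteq> F \<Longrightarrow> disjoint M \<Longrightarrow> card M < s"
    and num: "\<And>k. k \<le> card V \<Longrightarrow> k \<le> card (Pow V - F) \<Longrightarrow> s + k \<le> card V + 1 + k div 2"
  shows "\<exists>F'\<subseteq>Pow V. card F < card F' \<and> (\<forall>M\<subseteq>F'. disjoint M \<longrightarrow> card M < s)"
proof (rule ccontr)
  assume contra: "\<not> ?thesis"
  have finP: "finite (Pow V)" using V by simp
  have finF: "finite F" using F finP by (rule finite_subset)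
  \<comment> \<open>Otherwise the empty set could be traded for both \<open>A\<close> and
    \<open>B\<close>: a matching contains at most one of them, and putting the empty set in its
    place gives a matching in \<open>F\<close> of the same size.\<close>
  have pairwise: "A \<inter> B = {}" if A: "A \<in> Pow V - F" and B: "B \<in> Pow V - F" and AB: "A \<noteq> B" for A B
  proof (rule ccontr)
    assume int: "A \<inter> B \<noteq> {}"
    define F' where "F' = insert A (insert B (F - {{}}))"
    have "card (F - {{}}) = card F - 1" "card F > 0" using e finF by (auto simp: card_gt_0_iff)
    hence "card F < card F'" using A B AB finF unfolding F'_def by simp
    moreover have "F' \<subseteq> Pow V" using A B F unfolding F'_def by blast
    moreover have "card M < s" if M: "M \<subseteq> F'" "disjoint M" for M
    proof -
      define M' where "M' = insert {} (M - {A, B})"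
      have "M' \<subseteq> F" using M(1) e unfolding M'_def F'_def by blast
      moreover have "disjoint M'"
        using M(2) unfolding M'_def disjoint_def by simp
      ultimately have "card M' < s" by (rule no)
      have finM: "finite M" using M(1) finF finite_subset unfolding F'_def by blast
      have eM: "{} \<notin> M" using M(1) e A B unfolding F'_def by auto
      have "\<not> (A \<in> M \<and> B \<in> M)" using M(2) int AB disjointD by metis
      hence "card M \<le> card (M - {A, B}) + 1"
      proof -
        obtain Z where "M \<subseteq> insert Z (M - {A, B})" using \<open>\<not> (A \<in> M \<and> B \<in> M)\<close> by blast
        hence "card M \<le> card (insert Z (M - {A, B}))" using finM by (intro card_mono) auto
        also have "\<dots> \<le> card (M - {A, B}) + 1" using finM card_insert_le_m1 by (simp add: card_insert_if)
        finally show ?thesis .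
      qed
      also have "\<dots> = card M'" using eM finM unfolding M'_def by simp
      finally show ?thesis using \<open>card M' < s\<close> by simp
    qed
    ultimately show False using contra by blast
  qed
  \<comment> \<open>Two points of \<open>X\<close> form a member of \<open>F\<close>, as otherwise
    this pair and one of its singletons would be intersecting missing sets. The empty set, the
    singletons outside \<open>X\<close> and \<open>k div 2\<close> such pairs make a matching that
    is too large by \<open>num\<close>.\<close>
  define X where "X = {x \<in> V. {x} \<notin> F}"
  define k where "k = card X"
  have finX: "finite X" using V unfolding X_def by simp
  have kV: "k \<le> card V" unfolding k_def X_def using V by (intro card_mono) auto
  have "k = card ((\<lambda>x. {x}) ` X)" unfolding k_def by (simp add: card_image)
  also have "\<dots> \<le> card (Pow V - F)" using finP unfolding X_def by (intro card_mono) auto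
  finally have kF: "k \<le> card (Pow V - F)" .
  obtain g where g: "\<And>i. i < k div 2 \<Longrightarrow> g i \<subseteq> X" "\<And>i. i < k div 2 \<Longrightarrow> card (g i) = 2"
    "disjoint_family_on g {..<k div 2}"
    using disjoint_equal_parts[OF finX, of 2 "k div 2"] unfolding k_def by auto
  have gF: "g i \<in> F" if i: "i < k div 2" for i
  proof (rule ccontr)
    assume "g i \<notin> F"
    obtain a b where ab: "g i = {a, b}" "a \<noteq> b" using g(2)[OF i] by (auto simp: card_2_iff)
    have "{a} \<in> Pow V - F" "g i \<in> Pow V - F"
      using g(1)[OF i] ab \<open>g i \<notin> F\<close> unfolding X_def by auto
    moreover have "{a} \<noteq> g i" using ab by auto
    ultimately have "{a} \<inter> g i = {}" by (rule pairwise)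
    thus False using ab by simp
  qed
  define M1 where "M1 = (\<lambda>x. {x}) ` (V - X)"
  define M2 where "M2 = g ` {..<k div 2}"
  have inj: "inj_on g {..<k div 2}"
  proof (rule inj_onI)
    fix i j assume ij: "i \<in> {..<k div 2}" "j \<in> {..<k div 2}" "g i = g j"
    show "i = j"
    proof (rule ccontr)
      assume "i \<noteq> j"
      hence "g i = {}" using disjoint_family_onD[OF g(3) ij(1,2)] ij(3) by simp
      thus False using g(2)[of i] ij(1) by simp
    qed
  qed
  have "disjoint M1" unfolding M1_def disjoint_def by auto
  moreover have "disjoint M2" unfolding M2_def by (rule disjoint_family_on_disjoint_image[OF g(3)])
  moreover have U: "\<Union>M1 \<subseteq> V - X" "\<Union>M2 \<subseteq> X" using g(1) unfolding M1_def M2_def by auto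
  ultimately have "disjoint (M1 \<union> M2)" by (intro disjoint_union) blast+
  hence "disjoint (insert {} (M1 \<union> M2))" unfolding disjoint_def by simp
  moreover have "insert {} (M1 \<union> M2) \<subseteq> F" using gF e unfolding M1_def M2_def X_def by auto
  ultimately have less: "card (insert {} (M1 \<union> M2)) < s" using no by blast
  have ne: "{} \<notin> M1" "{} \<notin> M2" using g(2) unfolding M1_def M2_def by fastforce+
  have "M1 \<inter> M2 = {}"
  proof (rule ccontr)
    assume "M1 \<inter> M2 \<noteq> {}"
    then obtain D where "D \<in> M1" "D \<in> M2" by blast
    hence "D \<subseteq> V - X" "D \<subseteq> X" using U by blast+
    hence "D = {}" by blast
    thus False using ne \<open>D \<in> M1\<close> by simp
  qed
  moreover have "finite M1" "finite M2" using V unfolding M1_def M2_def by auto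
  moreover have "card M1 = card V - k" unfolding M1_def k_def
    using V finX by (simp add: card_image card_Diff_subset X_def)
  moreover have "card M2 = k div 2" unfolding M2_def using card_image[OF inj] by simp
  ultimately have "card (insert {} (M1 \<union> M2)) = 1 + (card V - k) + k div 2"
    using ne by (simp add: card_Un_disjoint)
  thus False using less num[OF kV kF] kV by linarith
qed

section \<open>Shifting in terms of counting functions\<close>

lemma count_le_conv:
  assumes "finite (A :: nat set)"
  shows "card (A \<inter> {..x}) = card {i. i < card A \<and> sorted_list_of_set A ! i \<le> x}"
proof -
  have "A \<inter> {..x} = set (filter (\<lambda>a. a \<le> x) (sorted_list_of_set A))" using assms by auto
  hence "card (A \<inter> {..x}) = length (filter (\<lambda>a. a \<le> x) (sorted_list_of_set A))"
    using assms by (metis distinct_card distinct_filter distinct_sorted_list_of_set)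
  thus ?thesis using assms by (simp add: length_filter_conv_card)
qed

text \<open>The element at index \<open>i\<close> of the sorted list is at most \<open>x\<close>
  exactly when more than \<open>i\<close> elements are. Counts are easy to follow through a swap and
  occur in the conditions defining \<open>Q\<close> and \<open>W\<close>.\<close>

lemma can_be_shifted_to_iff:
  "can_be_shifted_to A B \<longleftrightarrow> finite A \<and> finite B \<and> A \<subseteq> {1..} \<and> B \<subseteq> {1..} \<and>
     card A = card B \<and> (\<forall>x. card (A \<inter> {..x}) \<le> card (B \<inter> {..x}))"
proof (cases "finite A \<and> finite B")
  case True
  define xs ys where "xs = sorted_list_of_set A" and "ys = sorted_list_of_set B"
  have len: "length xs = card A" "length ys = card B" using True unfolding xs_def ys_def by auto
  have "list_all2 (\<lambda>a b. a \<ge> b) xs ys \<longleftrightarrow>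
      card A = card B \<and> (\<forall>x. card (A \<inter> {..x}) \<le> card (B \<inter> {..x}))"
  proof
    assume "list_all2 (\<lambda>a b. a \<ge> b) xs ys"
    hence le: "card A = card B" "\<And>i. i < card A \<Longrightarrow> ys ! i \<le> xs ! i"
      using len by (auto simp: list_all2_conv_all_nth)
    have "card (A \<inter> {..x}) \<le> card (B \<inter> {..x})" for x
    proof -
      have "{i. i < card A \<and> xs ! i \<le> x} \<subseteq> {i. i < card B \<and> ys ! i \<le> x}"
        using le by (auto intro: order_trans)
      hence "card {i. i < card A \<and> xs ! i \<le> x} \<le> card {i. i < card B \<and> ys ! i \<le> x}"
        by (intro card_mono) auto
      thus ?thesis using True unfolding xs_def ys_def by (simp add: count_le_conv)
    qed
    thus "card A = card B \<and> (\<forall>x. card (A \<inter> {..x}) \<le> card (B \<inter> {..x}))" using le by blast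
  next
    assume *: "card A = card B \<and> (\<forall>x. card (A \<inter> {..x}) \<le> card (B \<inter> {..x}))"
    show "list_all2 (\<lambda>a b. a \<ge> b) xs ys"
      unfolding list_all2_conv_all_nth
    proof (intro conjI allI impI)
      show "length xs = length ys" using * len by simp
      fix i assume i: "i < length xs"
      show "ys ! i \<le> xs ! i"
      proof (rule ccontr)
        assume "\<not> ys ! i \<le> xs ! i"
        hence lt: "xs ! i < ys ! i" by simp
        have sx: "sorted xs" "sorted ys" unfolding xs_def ys_def by simp_all
        \<comment> \<open>At the cutoff \<open>xs ! i\<close> the set \<open>A\<close> already has
          \<open>i + 1\<close> elements, while \<open>B\<close> has at most
          \<open>i\<close>.\<close>
        have "{..i} \<subseteq> {j. j < card A \<and> xs ! j \<le> xs ! i}"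
          using i len sorted_nth_mono[OF sx(1)] by auto
        hence "card {..i} \<le> card {j. j < card A \<and> xs ! j \<le> xs ! i}" by (intro card_mono) auto
        also have "\<dots> = card (A \<inter> {..xs ! i})" using True unfolding xs_def by (simp add: count_le_conv)
        also have "\<dots> \<le> card (B \<inter> {..xs ! i})" using * by blast
        also have "\<dots> = card {j. j < card B \<and> ys ! j \<le> xs ! i}"
          using True unfolding ys_def by (simp add: count_le_conv)
        also have "\<dots> \<le> card {..<i}"
        proof (rule card_mono)
          show "{j. j < card B \<and> ys ! j \<le> xs ! i} \<subseteq> {..<i}"
          proof
            fix j assume "j \<in> {j. j < card B \<and> ys ! j \<le> xs ! i}"
            hence j: "j < length ys" "ys ! j < ys ! i" using lt len by auto
            show "j \<in> {..<i}"
              using sorted_nth_mono[OF sx(2), of i j] j by (cases "j < i") auto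
          qed
        qed simp
        finally show False by simp
      qed
    qed
  qed
  thus ?thesis unfolding can_be_shifted_to_def xs_def ys_def by blast
qed (auto simp: can_be_shifted_to_def)

lemma shifted_swap:
  assumes F: "shifted F" and A: "A \<in> F" "finite A" "A \<subseteq> {1..}"
    and xy: "x \<in> A" "y \<notin> A" "1 \<le> y" "y < x"
  shows "insert y (A - {x}) \<in> F"
proof -
  have "card (A \<inter> {..z}) \<le> card (insert y (A - {x}) \<inter> {..z})" for z
  proof (cases "x \<le> z")
    case True
    hence "insert y (A - {x}) \<inter> {..z} = insert y ((A \<inter> {..z}) - {x})" using xy by auto
    moreover have "card (insert y ((A \<inter> {..z}) - {x})) = Suc (card ((A \<inter> {..z}) - {x}))"
      using A xy by simp
    moreover have "Suc (card ((A \<inter> {..z}) - {x})) = card (A \<inter> {..z})"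
      using A xy True by (intro card_Suc_Diff1) auto
    ultimately show ?thesis by simp
  next
    case False
    thus ?thesis using A by (intro card_mono) auto
  qed
  moreover have "card A = card (insert y (A - {x}))"
    using A xy card_Suc_Diff1[of A x] by simp
  ultimately have "can_be_shifted_to A (insert y (A - {x}))"
    using A xy unfolding can_be_shifted_to_iff by auto
  thus ?thesis using F A(1) unfolding shifted_def by blast
qed

lemma can_be_shifted_to_Icc:
  assumes "can_be_shifted_to A B"
  shows "card A = card B" "card (A \<inter> {1..x}) \<le> card (B \<inter> {1..x})" "A \<subseteq> {1..n} \<Longrightarrow> B \<subseteq> {1..n}"
proof -
  have *: "finite A" "finite B" "A \<subseteq> {1..}" "B \<subseteq> {1..}" "card A = card B"
    "\<And>x. card (A \<inter> {..x}) \<le> card (B \<inter> {..x})"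
    using assms unfolding can_be_shifted_to_iff by auto
  have "A \<inter> {1..x} = A \<inter> {..x}" "B \<inter> {1..x} = B \<inter> {..x}" for x using * by auto
  thus le: "card (A \<inter> {1..x}) \<le> card (B \<inter> {1..x})" for x using * by simp
  show "card A = card B" by fact
  assume "A \<subseteq> {1..n}"
  hence "card B \<le> card (B \<inter> {1..n})" using le[of n] * by (simp add: Int_absorb2)
  hence "B \<inter> {1..n} = B" using * by (intro card_seteq) auto
  thus "B \<subseteq> {1..n}" by blast
qed

lemma sum_card_disjoint_le:
  assumes "finite V" "disjoint_family_on f {..<s::nat}"
  shows "(\<Sum>i<s. card (f i \<inter> V)) \<le> card V"
proof -
  have "(\<Sum>i<s. card (f i \<inter> V)) = card (\<Union>i<s. f i \<inter> V)"
    using assms by (intro card_UN_disjoint[symmetric]) (auto simp: disjoint_family_on_def)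
  also have "\<dots> \<le> card V" using assms(1) by (intro card_mono) auto
  finally show ?thesis .
qed

section \<open>Asymptotics and the extremal families\<close>

lemma tendsto_linear_over_n:
  assumes "m \<ge> 1"
  shows "(\<lambda>s. real (m * s + b - K) / real s) \<longlonglongrightarrow> real m"
proof (rule Lim_transform_eventually)
  have "(\<lambda>s. real m + (real b - real K) / real s) \<longlonglongrightarrow> real m + 0"
    by (intro tendsto_add tendsto_const lim_const_over_n)
  thus "(\<lambda>s. real m + (real b - real K) / real s) \<longlonglongrightarrow> real m" by simp
  show "\<forall>\<^sub>F s in sequentially. real m + (real b - real K) / real s = real (m * s + b - K) / real s"
    using eventually_ge_at_top[of "Suc K"]
  proof eventually_elim
    case (elim s)
    have "1 * s \<le> m * s" using assms by (intro mult_le_mono1)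
    hence "K \<le> m * s + b" using elim by linarith
    thus ?case using elim by (simp add: of_nat_diff field_simps)
  qed
qed

lemma tendsto_choose_over_power:
  assumes "(\<lambda>s. real (x s) / real s) \<longlonglongrightarrow> p"
  shows "(\<lambda>s. real (x s choose a) / real s ^ a) \<longlonglongrightarrow> p ^ a / fact a"
proof (induction a)
  case (Suc a)
  have step: "real (n choose Suc a) = real (n choose a) * (real n - real a) / real (Suc a)" for n
  proof -
    have "Suc a * (n choose Suc a) = (n - a) * (n choose a)"
      by (simp only: binomial_absorption binomial_absorb_comp)
    hence "real (Suc a) * real (n choose Suc a) = real (n - a) * real (n choose a)"
      by (metis of_nat_mult)
    \<comment> \<open>For \<open>a > n\<close> the truncated difference is harmless because
      \<open>n choose a\<close> vanishes.\<close>
    also have "\<dots> = (real n - real a) * real (n choose a)"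
      by (cases "a \<le> n") (simp_all add: of_nat_diff)
    finally show ?thesis by (simp add: field_simps)
  qed
  have "(\<lambda>s. real (x s) / real s - real a / real s) \<longlonglongrightarrow> p - 0"
    by (intro tendsto_diff assms lim_const_over_n)
  hence "(\<lambda>s. (real (x s choose a) / real s ^ a) * (real (x s) / real s - real a / real s) / real (Suc a))
      \<longlonglongrightarrow> (p ^ a / fact a) * (p - 0) / real (Suc a)"
    by (intro tendsto_divide tendsto_mult Suc.IH tendsto_const) simp_all
  moreover have "(p ^ a / fact a) * (p - 0) / real (Suc a) = p ^ Suc a / fact (Suc a)"
    by (simp add: field_simps)
  moreover have "(real (x s choose a) / real s ^ a) * (real (x s) / real s - real a / real s) / real (Suc a)
      = real (x s choose Suc a) / real s ^ Suc a" for s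
    unfolding step by (simp add: diff_divide_distrib[symmetric])
  ultimately show ?case by simp
qed simp

lemma tendsto_choose_over_power_less:
  assumes "(\<lambda>s. real (x s) / real s) \<longlonglongrightarrow> p" and "j < a"
  shows "(\<lambda>s. real (x s choose j) / real s ^ a) \<longlonglongrightarrow> 0"
proof -
  have "(\<lambda>s. (real (x s choose j) / real s ^ j) * (1 / real s) ^ (a - j)) \<longlonglongrightarrow> (p ^ j / fact j) * 0 ^ (a - j)"
    by (intro tendsto_mult tendsto_choose_over_power assms tendsto_power lim_const_over_n)
  moreover have "(real (x s choose j) / real s ^ j) * (1 / real s) ^ (a - j) = real (x s choose j) / real s ^ a" for s
  proof -
    have "real s ^ a = real s ^ j * real s ^ (a - j)" using assms(2) by (simp flip: power_add)
    thus ?thesis by (simp add: power_divide)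
  qed
  ultimately show ?thesis using assms(2) by (simp add: zero_power)
qed

lemma eventually_less_of_tendsto:
  fixes f g :: "nat \<Rightarrow> nat"
  assumes "(\<lambda>s. real (f s) / real s ^ a) \<longlonglongrightarrow> p" and "(\<lambda>s. real (g s) / real s ^ a) \<longlonglongrightarrow> q" and "p < q"
  shows "\<forall>\<^sub>F s in sequentially. f s < g s"
proof -
  have "(\<lambda>s. real (g s) / real s ^ a - real (f s) / real s ^ a) \<longlonglongrightarrow> q - p"
    by (intro tendsto_diff assms)
  hence "\<forall>\<^sub>F s in sequentially. 0 < real (g s) / real s ^ a - real (f s) / real s ^ a"
    using assms(3) by (intro order_tendstoD(1)) auto
  thus ?thesis
    using eventually_gt_at_top[of 0]
    by eventually_elim (simp add: zero_less_divide_iff flip: diff_divide_distrib)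
qed

text \<open>Let \<open>P\<close> have \<open>a\<close> points up to \<open>h\<close> and
  \<open>d\<close> beyond; \<open>P\<close> is counted when \<open>2 * a + d < 2 * m\<close>. For
  \<open>a = m - 1\<close> this forces \<open>d \<le> 1\<close>, which gives the dominant first
  term; for \<open>a < m - 1\<close> the upper part is counted without restriction.\<close>

lemma card_not_Q_le:
  fixes n h m :: nat
  assumes hn: "h \<le> n" and m: "m \<ge> 1"
  shows "card (Pow {1..n} - {P. P \<subseteq> {1..n} \<and> 2 * m \<le> card P + card (P \<inter> {1..h})})
    \<le> (n - h + 1) * (h choose (m - 1)) + 2 ^ (n - h) * (\<Sum>j<m-1. h choose j)"
    (is "card ?N \<le> _")
proof -
  define T where "T = {h<..n}"
  define K where "K j = {A. A \<subseteq> {1..h} \<and> card A = j}" for j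
  define S1 where "S1 = K (m - 1) \<times> insert {} ((\<lambda>x. {x}) ` T)"
  define S2 where "S2 = (\<Union>j<m-1. K j) \<times> Pow T"
  have cT: "card T = n - h" "finite T" unfolding T_def by simp_all
  have finK: "finite (K j)" for j unfolding K_def by simp
  have cK: "card (K j) = h choose j" for j
    using n_subsets[of "{1..h}" j] unfolding K_def by simp
  have "card S1 = (h choose (m - 1)) * (n - h + 1)"
    unfolding S1_def card_cartesian_product cK using cT by (simp add: card_image image_iff)
  moreover have "card S2 \<le> (\<Sum>j<m-1. h choose j) * 2 ^ (n - h)"
  proof -
    have "card (\<Union>j<m-1. K j) \<le> (\<Sum>j<m-1. card (K j))" by (rule card_UN_le) simp
    thus ?thesis unfolding S2_def card_cartesian_product using cT by (simp add: cK card_Pow)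
  qed
  moreover have "?N \<subseteq> (\<lambda>(A, D). A \<union> D) ` (S1 \<union> S2)"
  proof
    fix P assume P: "P \<in> ?N"
    define A D where "A = P \<inter> {1..h}" and "D = P \<inter> T"
    have PAD: "P = A \<union> D" using P hn unfolding A_def D_def T_def by fastforce
    have fin: "finite A" "finite D" unfolding A_def D_def T_def by simp_all
    have "card P = card A + card D"
      unfolding PAD using fin by (intro card_Un_disjoint) (auto simp: A_def D_def T_def)
    hence less: "2 * card A + card D < 2 * m" using P unfolding A_def by auto
    have "(A, D) \<in> S1 \<union> S2"
    proof (cases "card A < m - 1")
      case True
      thus ?thesis unfolding S2_def K_def A_def D_def by auto
    next
      case False
      hence "card A = m - 1" "card D \<le> 1" using less m by linarith+
      moreover from this fin have "D = {} \<or> (\<exists>x. D = {x})"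
        by (cases "card D") (auto simp: card_1_singleton_iff)
      ultimately show ?thesis unfolding S1_def K_def A_def D_def by blast
    qed
    thus "P \<in> (\<lambda>(A, D). A \<union> D) ` (S1 \<union> S2)" using PAD by force
  qed
  moreover have "finite (S1 \<union> S2)" unfolding S1_def S2_def using finK cT by auto
  ultimately have "card ?N \<le> card S1 + card S2"
    by (meson card_Un_le order_trans surj_card_le)
  thus ?thesis using \<open>card S1 = _\<close> \<open>card S2 \<le> _\<close> by (simp add: mult.commute)
qed

section \<open>The maximum and the two candidate families\<close>

lemma max_family_size_attained:
  assumes "s \<ge> 1"
  shows "\<exists>F\<subseteq>Pow {1..n}. matching_number F < s \<and> card F = max_family_size n s"
    and "F \<subseteq> Pow {1..n} \<Longrightarrow> matching_number F < s \<Longrightarrow> card F \<le> max_family_size n s"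
proof -
  define C where "C = {card F | F. F \<subseteq> Pow {1..n} \<and> matching_number F < s}"
  have "C \<subseteq> card ` Pow (Pow {1..n})" unfolding C_def by blast
  hence fin: "finite C" by (rule finite_subset) simp
  have "matching_number ({} :: nat set set) < s"
    using assms by (simp add: matching_number_less_iff_card)
  hence "card ({} :: nat set set) \<in> C" unfolding C_def by blast
  hence "Max C \<in> C" using fin by (intro Max_in) auto
  thus "\<exists>F\<subseteq>Pow {1..n}. matching_number F < s \<and> card F = max_family_size n s"
  proof -
    assume "Max C \<in> C"
    then obtain F where "F \<subseteq> Pow {1..n}" "matching_number F < s" "card F = Max C"
      unfolding C_def by force
    thus ?thesis unfolding max_family_size_def C_def[symmetric] by blast
  qed
  show "card F \<le> max_family_size n s" if "F \<subseteq> Pow {1..n}" "matching_number F < s"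
    unfolding max_family_size_def C_def[symmetric] using that fin by (intro Max_ge) (auto simp: C_def)
qed

lemma Q_family_eq:
  assumes "n = m * s + c" and "c \<le> s"
  shows "Q_family m s (s - c) = {P. P \<subseteq> {1..n} \<and> 2 * m \<le> card P + card (P \<inter> {1..n-(2*c+1)})}"
proof -
  have "m * s - c - 1 = n - (2 * c + 1)" using assms by simp
  thus ?thesis using assms unfolding Q_family_def by (simp add: Let_def)
qed

lemma W_family_eq:
  assumes "n = m * s + 1" and "1 \<le> s"
  shows "W_family m s (s - 1) = {P. P \<subseteq> {1..n} \<and> m \<le> card (P \<inter> {1..n-2})}"
proof -
  have "m * s - 1 = n - 2" "s - (s - 1) = 1" using assms by simp_all
  thus ?thesis using assms unfolding W_family_def by (simp add: Let_def)
qed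

text \<open>Points up to \<open>n-(2*c+1)\<close> have weight 2 and later points weight 1. The total
  is \<open>2 * m * s - 1\<close>, one less than \<open>s\<close> disjoint members need. The bound
  on \<open>c\<close> keeps the subtraction exact.\<close>

lemma no_matching_Q:
  assumes n: "n = m * s + c" and c: "c + 1 \<le> m * s"
  shows "\<not> has_matching s {P. P \<subseteq> {1..n} \<and> 2 * m \<le> card P + card (P \<inter> {1..n-(2*c+1)})}"
proof
  assume "has_matching s {P. P \<subseteq> {1..n} \<and> 2 * m \<le> card P + card (P \<inter> {1..n-(2*c+1)})}"
  then obtain f where f: "\<And>i. i < s \<Longrightarrow> f i \<subseteq> {1..n} \<and> 2 * m \<le> card (f i) + card (f i \<inter> {1..n-(2*c+1)})"
    and d: "disjoint_family_on f {..<s}"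
    unfolding has_matching_def by blast
  have "s * (2 * m) \<le> (\<Sum>i<s. card (f i \<inter> {1..n}) + card (f i \<inter> {1..n-(2*c+1)}))"
    using f sum_mono[of "{..<s}" "\<lambda>_. 2 * m" "\<lambda>i. card (f i \<inter> {1..n}) + card (f i \<inter> {1..n-(2*c+1)})"]
    by (simp add: Int_absorb2)
  also have "\<dots> \<le> card {1..n} + card {1..n-(2*c+1)}"
    unfolding sum.distrib by (intro add_mono sum_card_disjoint_le d) simp_all
  finally have "2 * (m * s) \<le> n + (n - (2 * c + 1))" by (simp add: ac_simps)
  thus False using n c by linarith
qed

text \<open>Only \<open>m * s - 1\<close> points count, one fewer than \<open>s\<close> disjoint
  members would occupy.\<close>

lemma no_matching_W:
  assumes n: "n = m * s + 1" and ms: "1 \<le> m * s"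
  shows "\<not> has_matching s {P. P \<subseteq> {1..n} \<and> m \<le> card (P \<inter> {1..n-2})}"
proof
  assume "has_matching s {P. P \<subseteq> {1..n} \<and> m \<le> card (P \<inter> {1..n-2})}"
  then obtain f where f: "\<And>i. i < s \<Longrightarrow> m \<le> card (f i \<inter> {1..n-2})"
    and d: "disjoint_family_on f {..<s}"
    unfolding has_matching_def by blast
  have "s * m \<le> (\<Sum>i<s. card (f i \<inter> {1..n-2}))"
    using f sum_mono[of "{..<s}" "\<lambda>_. m" "\<lambda>i. card (f i \<inter> {1..n-2})"] by simp
  also have "\<dots> \<le> card {1..n-2}" by (intro sum_card_disjoint_le d) simp_all
  finally have "m * s \<le> n - 2" by (simp add: ac_simps)
  thus False using n ms by linarith
qed

text \<open>Exchanging the traces \<open>{n-2}\<close> and \<open>{n-1, n}\<close> on the last three points turns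
  one family into the other.\<close>

lemma card_W_eq_card_Q:
  fixes n m :: nat
  assumes n: "3 \<le> n"
  shows "card {P. P \<subseteq> {1..n} \<and> m \<le> card (P \<inter> {1..n-2})} =
    card {P. P \<subseteq> {1..n} \<and> 2 * m \<le> card P + card (P \<inter> {1..n-3})}" (is "card ?W = card ?Q")
proof -
  define \<phi> where "\<phi> D = (if D = {n-2} then {n-1, n} else if D = {n-1, n} then {n-2} else D)" for D
  define T where "T = {n-2, n-1, n}"
  define \<psi> where "\<psi> P = (P \<inter> {1..n-3}) \<union> \<phi> (P \<inter> T)" for P
  have T: "{1..n} = {1..n-3} \<union> T" "{1..n-3} \<inter> T = {}" using n unfolding T_def by auto
  have \<phi>T: "\<phi> D \<subseteq> T" if "D \<subseteq> T" for D using that unfolding \<phi>_def T_def by auto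
  have \<phi>\<phi>: "\<phi> (\<phi> D) = D" for D using n unfolding \<phi>_def by auto
  have \<psi>1: "\<psi> P \<inter> {1..n-3} = P \<inter> {1..n-3}" "\<psi> P \<inter> T = \<phi> (P \<inter> T)" for P
    using T \<phi>T[of "P \<inter> T"] unfolding \<psi>_def by blast+
  have \<psi>\<psi>: "\<psi> (\<psi> P) = P" if "P \<subseteq> {1..n}" for P
  proof -
    have "\<psi> (\<psi> P) = (P \<inter> {1..n-3}) \<union> (P \<inter> T)" unfolding \<psi>_def[of "\<psi> P"] \<psi>1 \<phi>\<phi> ..
    thus ?thesis using that T by blast
  qed
  have \<psi>sub: "\<psi> P \<subseteq> {1..n}" for P using T \<phi>T[of "P \<inter> T"] unfolding \<psi>_def by blast
  have key: "m \<le> card (P \<inter> {1..n-2}) \<longleftrightarrow> 2 * m \<le> card (\<psi> P) + card (\<psi> P \<inter> {1..n-3})" if P: "P \<subseteq> {1..n}" for P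
  proof -
    define j where "j = card (P \<inter> {1..n-3})"
    define D where "D = P \<inter> T"
    have "P \<inter> {1..n-2} = (P \<inter> {1..n-3}) \<union> (D \<inter> {n-2})" using n unfolding D_def T_def by auto
    moreover have "card \<dots> = j + card (D \<inter> {n-2})"
      unfolding j_def using n by (intro card_Un_disjoint) auto
    ultimately have 1: "card (P \<inter> {1..n-2}) = j + card (D \<inter> {n-2})" by simp
    have "D \<subseteq> T" unfolding D_def by simp
    hence fin: "finite (\<phi> D)" using \<phi>T[of D] finite_subset unfolding T_def by blast
    have "card (\<psi> P) = j + card (\<phi> D)"
      unfolding \<psi>_def j_def D_def[symmetric] using fin \<phi>T[OF \<open>D \<subseteq> T\<close>] T by (intro card_Un_disjoint) auto
    hence 2: "card (\<psi> P) + card (\<psi> P \<inter> {1..n-3}) = 2 * j + card (\<phi> D)"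
      unfolding \<psi>1 j_def by simp
    have "D \<in> Pow {n-2, n-1, n}" using \<open>D \<subseteq> T\<close> unfolding T_def by simp
    hence "D \<in> {{}, {n-2}, {n-1}, {n}, {n-2, n-1}, {n-2, n}, {n-1, n}, {n-2, n-1, n}}"
      by (simp add: Pow_insert) blast
    moreover have ne: "n - 2 \<noteq> n - 1" "n - 2 \<noteq> n" "n - 1 \<noteq> n" using n by auto
    \<comment> \<open>A trace \<open>D\<close> contains \<open>n-2\<close> exactly when
      \<open>\<phi> D\<close> has at least two elements. As \<open>j\<close> enters the two
      conditions with factors 1 and 2, this decides both thresholds alike.\<close>
    ultimately have "card (D \<inter> {n-2}) = 0 \<and> card (\<phi> D) \<le> 1 \<or> card (D \<inter> {n-2}) = 1 \<and> (card (\<phi> D) = 2 \<or> card (\<phi> D) = 3)"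
      unfolding \<phi>_def by (auto simp: doubleton_eq_iff)
    thus ?thesis unfolding 1 2 by presburger
  qed
  have "bij_betw \<psi> ?W ?Q"
  proof (rule bij_betw_byWitness[where f' = \<psi>])
    show "\<psi> ` ?W \<subseteq> ?Q" using key \<psi>sub by blast
    show "\<psi> ` ?Q \<subseteq> ?W"
    proof
      fix R assume "R \<in> \<psi> ` ?Q"
      then obtain P where P: "P \<in> ?Q" "R = \<psi> P" by blast
      have "m \<le> card (\<psi> P \<inter> {1..n-2})" using key[OF \<psi>sub, of P] \<psi>\<psi>[of P] P(1) by simp
      thus "R \<in> ?W" using P \<psi>sub by blast
    qed
  qed (use \<psi>\<psi> in auto)
  thus ?thesis by (rule bij_betw_same_card)
qed

text \<open>After division by \<open>s ^ (m - 1) / fact (m - 1)\<close> the left side, which bounds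
  the number of sets outside \<open>Q\<close>, tends to \<open>(2 * c + 2) * m ^ (m - 1)\<close>,
  the lower binomials vanishing. The right sides tend to \<open>L\<close> and to
  \<open>(2 * c + 3) * m ^ (m - 1)\<close>.\<close>

lemma eventually_bounds:
  fixes m c :: nat
  assumes m: "m \<ge> 1" and L: "(2 * c + 2) * m ^ (m - 1) < L"
  shows "\<forall>\<^sub>F s in sequentially.
     (2 * c + 2) * ((m * s + c - (2 * c + 1)) choose (m - 1))
        + 2 ^ (2 * c + 1) * (\<Sum>j<m-1. (m * s + c - (2 * c + 1)) choose j)
      < L * ((s - L) choose (m - 1))" (is "\<forall>\<^sub>F s in _. ?f s < ?g s")
    and "\<forall>\<^sub>F s in sequentially.
     (2 * c + 2) * ((m * s + c - (2 * c + 1)) choose (m - 1))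
        + 2 ^ (2 * c + 1) * (\<Sum>j<m-1. (m * s + c - (2 * c + 1)) choose j)
      < (2 * c + 3) * ((m * s + c - K) choose (m - 1))" (is "\<forall>\<^sub>F s in _. _ < ?h s")
proof -
  note lin = tendsto_linear_over_n[OF m, of c]
  have "(\<lambda>s. real (2 * c + 2) * (real ((m * s + c - (2 * c + 1)) choose (m - 1)) / real s ^ (m - 1))
      + 2 ^ (2 * c + 1) * (\<Sum>j<m-1. real ((m * s + c - (2 * c + 1)) choose j) / real s ^ (m - 1)))
     \<longlonglongrightarrow> real (2 * c + 2) * (real m ^ (m - 1) / fact (m - 1)) + 2 ^ (2 * c + 1) * (\<Sum>j<m-1. 0)"
    by (intro tendsto_add tendsto_mult tendsto_const tendsto_sum tendsto_choose_over_power[OF lin]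
        tendsto_choose_over_power_less[OF lin]) simp
  moreover have "real (2 * c + 2) * (real ((m * s + c - (2 * c + 1)) choose (m - 1)) / real s ^ (m - 1))
      + 2 ^ (2 * c + 1) * (\<Sum>j<m-1. real ((m * s + c - (2 * c + 1)) choose j) / real s ^ (m - 1))
    = real (?f s) / real s ^ (m - 1)" for s
    by (simp only: of_nat_add of_nat_mult of_nat_sum of_nat_power of_nat_numeral
        add_divide_distrib times_divide_eq_right sum_divide_distrib[symmetric])
  ultimately have f: "(\<lambda>s. real (?f s) / real s ^ (m - 1))
      \<longlonglongrightarrow> real (2 * c + 2) * (real m ^ (m - 1) / fact (m - 1))" by simp
  have "(\<lambda>s. real (1 * s + 0 - L) / real s) \<longlonglongrightarrow> real 1" by (rule tendsto_linear_over_n) simp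
  hence "(\<lambda>s. real (s - L) / real s) \<longlonglongrightarrow> 1" by simp
  hence "(\<lambda>s. real L * (real ((s - L) choose (m - 1)) / real s ^ (m - 1)))
      \<longlonglongrightarrow> real L * (1 ^ (m - 1) / fact (m - 1))"
    by (intro tendsto_mult tendsto_const tendsto_choose_over_power)
  hence g: "(\<lambda>s. real (?g s) / real s ^ (m - 1)) \<longlonglongrightarrow> real L * (1 / fact (m - 1))" by simp
  have "(\<lambda>s. real (2 * c + 3) * (real ((m * s + c - K) choose (m - 1)) / real s ^ (m - 1)))
      \<longlonglongrightarrow> real (2 * c + 3) * (real m ^ (m - 1) / fact (m - 1))"
    by (intro tendsto_mult tendsto_const tendsto_choose_over_power lin)
  hence h: "(\<lambda>s. real (?h s) / real s ^ (m - 1)) \<longlonglongrightarrow> real (2 * c + 3) * (real m ^ (m - 1) / fact (m - 1))"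
    by (simp only: of_nat_mult times_divide_eq_right)
  have "real ((2 * c + 2) * m ^ (m - 1)) < real L" using L by (rule of_nat_less_iff[THEN iffD2])
  hence "real ((2 * c + 2) * m ^ (m - 1)) / fact (m - 1) < real L / fact (m - 1)"
    by (rule divide_strict_right_mono) simp
  hence "real (2 * c + 2) * (real m ^ (m - 1) / fact (m - 1)) < real L * (1 / fact (m - 1))"
    by (simp only: of_nat_mult of_nat_power times_divide_eq_right mult_1_right)
  thus "\<forall>\<^sub>F s in sequentially. ?f s < ?g s" by (rule eventually_less_of_tendsto[OF f g])
  have "real (2 * c + 2) * (real m ^ (m - 1) / fact (m - 1)) < real (2 * c + 3) * (real m ^ (m - 1) / fact (m - 1))"
    using m by (intro mult_strict_right_mono) auto
  thus "\<forall>\<^sub>F s in sequentially. ?f s < ?h s" by (rule eventually_less_of_tendsto[OF f h])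
qed

text \<open>A missing \<open>B\<close> could be added: in any matching that uses \<open>B\<close>,
  its subset \<open>A\<close> can stand in for it. \<open>A\<close> is nonempty, so it differs from
  the other members and the size of the matching is kept.\<close>

lemma maximum_family_upward_closed:
  assumes F: "F \<subseteq> Pow {1..n}" "{} \<notin> F" "matching_number F < s" "card F = max_family_size n s"
    and s: "s \<ge> 1" and AB: "A \<in> F" "A \<subseteq> B" "B \<subseteq> {1..n}"
  shows "B \<in> F"
proof (rule ccontr)
  assume B: "B \<notin> F"
  have finF: "finite F" using F(1) by (rule finite_subset) simp
  have no: "\<And>M. M \<subseteq> F \<Longrightarrow> disjoint M \<Longrightarrow> card M < s"
    using F(3) unfolding matching_number_less_iff_card[OF finF] by blast
  have "card M < s" if M: "M \<subseteq> insert B F" "disjoint M" for M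
  proof (cases "B \<in> M")
    case False
    hence "M \<subseteq> F" using M(1) by blast
    thus ?thesis using no M(2) by blast
  next
    case True
    have ne: "A \<noteq> {}" using AB F(2) by blast
    have "A \<inter> C = {}" if "C \<in> M - {B}" for C
      using disjointD[OF M(2), of B C] True that AB(2) by blast
    moreover from this have "A \<notin> M - {B}" using ne by blast
    moreover have "disjoint (M - {B})" using M(2) unfolding disjoint_def by simp
    ultimately have "disjoint (insert A (M - {B}))" unfolding disjoint_def by (auto simp: Int_commute)
    moreover have "insert A (M - {B}) \<subseteq> F" using M(1) AB(1) by blast
    ultimately have "card (insert A (M - {B})) < s" using no by blast
    moreover have "card (insert A (M - {B})) = card M"
    proof -
      have "finite M" using M(1) finF finite_subset by blast
      thus ?thesis using True \<open>A \<notin> M - {B}\<close> card_Suc_Diff1[of M B] by simp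
    qed
    ultimately show ?thesis by simp
  qed
  hence "matching_number (insert B F) < s"
    using finF by (simp add: matching_number_less_iff_card)
  hence "card (insert B F) \<le> max_family_size n s"
    using F(1) AB(3) by (intro max_family_size_attained(2)[OF s]) auto
  thus False using F(4) B finF by simp
qed

section \<open>Shiftedness and uniqueness of the extremal families\<close>

lemma shifted_Q: "shifted {P. P \<subseteq> {1..n} \<and> k \<le> card P + card (P \<inter> {1..h})}"
  unfolding shifted_def
proof (intro ballI allI impI)
  fix A B assume A: "A \<in> {P. P \<subseteq> {1..n} \<and> k \<le> card P + card (P \<inter> {1..h})}" and AB: "can_be_shifted_to A B"
  have "B \<subseteq> {1..n}" using can_be_shifted_to_Icc(3)[OF AB] A by blast
  thus "B \<in> {P. P \<subseteq> {1..n} \<and> k \<le> card P + card (P \<inter> {1..h})}"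
    using can_be_shifted_to_Icc(1)[OF AB] can_be_shifted_to_Icc(2)[OF AB, of h] A by simp
qed

lemma shifted_W: "shifted {P. P \<subseteq> {1..n} \<and> k \<le> card (P \<inter> {1..h})}"
  unfolding shifted_def
proof (intro ballI allI impI)
  fix A B assume A: "A \<in> {P. P \<subseteq> {1..n} \<and> k \<le> card (P \<inter> {1..h})}" and AB: "can_be_shifted_to A B"
  have "B \<subseteq> {1..n}" using can_be_shifted_to_Icc(3)[OF AB] A by blast
  thus "B \<in> {P. P \<subseteq> {1..n} \<and> k \<le> card (P \<inter> {1..h})}"
    using can_be_shifted_to_Icc(2)[OF AB, of h] A by simp
qed

lemma extremal_families:
  fixes m c s n L :: nat
  defines "Q \<equiv> {P. P \<subseteq> {1..n} \<and> 2 * m \<le> card P + card (P \<inter> {1..n-(2*c+1)})}"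
    and "W \<equiv> {P. P \<subseteq> {1..n} \<and> m \<le> card (P \<inter> {1..n-2})}"
    and "u \<equiv> (2 * c + 2) * ((n - (2 * c + 1)) choose (m - 1))
        + 2 ^ (2 * c + 1) * (\<Sum>j<m-1. (n - (2 * c + 1)) choose j)"
  assumes n: "n = m * s + c" and m: "m \<ge> 1" and c: "c \<ge> 1" and L: "2 * c + 1 \<le> L" and s: "L + 2 \<le> s"
    and u1: "u < L * ((s - L) choose (m - 1))"
    and u2: "u < (2 * c + 3) * ((n - (L + ((m - 1) * L + m) + m - 1)) choose (m - 1))"
  shows "max_family_size n s = card Q"
    and "{F. F \<subseteq> Pow {1..n} \<and> shifted F \<and> matching_number F < s \<and> card F = max_family_size n s}
      = (if c = 1 then {Q, W} else {Q})"
proof -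
  let ?e = "max_family_size n s"
  have s1: "s \<ge> 1" and sc: "2 * c + 3 \<le> s" using s L by auto
  have "1 * s \<le> m * s" using m by (intro mult_le_mono1)
  hence ms: "s \<le> m * s" by simp
  have nc: "2 * c + 3 \<le> n" using ms sc n by linarith
  have finP: "finite (Pow {1..n})" by simp
  have fin: "finite F" if "F \<subseteq> Pow {1..n}" for F using that finP by (rule finite_subset)
  have subQ: "Q \<subseteq> Pow {1..n}" and subW: "W \<subseteq> Pow {1..n}" unfolding Q_def W_def by auto
  have eQ: "{} \<notin> Q" and eW: "{} \<notin> W" using m unfolding Q_def W_def by auto
  have "\<not> has_matching s Q"
    unfolding Q_def using ms sc by (intro no_matching_Q[OF n]) linarith
  hence mQ: "matching_number Q < s"
    by (simp only: matching_number_less_iff[OF fin[OF subQ] eQ] not_False_eq_True)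
  have mW: "matching_number W < s" if "c = 1"
  proof -
    have "\<not> has_matching s W"
      unfolding W_def using ms sc n that by (intro no_matching_W) auto
    thus ?thesis by (simp only: matching_number_less_iff[OF fin[OF subW] eW] not_False_eq_True)
  qed
  have cW: "card W = card Q" if "c = 1"
    using card_W_eq_card_Q[of n m] nc that unfolding Q_def W_def by simp
  have Qe: "card Q \<le> ?e" by (rule max_family_size_attained(2)[OF s1 subQ mQ])
  have few: "card (Pow {1..n} - F) \<le> u" if F: "F \<subseteq> Pow {1..n}" "card F = ?e" for F
  proof -
    have "card (Pow {1..n} - F) = card (Pow {1..n}) - ?e"
      using card_Diff_subset[OF fin[OF F(1)] F(1)] F(2) by simp
    also have "\<dots> \<le> card (Pow {1..n}) - card Q" using Qe by simp
    also have "\<dots> = card (Pow {1..n} - Q)" using card_Diff_subset[OF fin[OF subQ] subQ] by simp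
    also have "\<dots> \<le> (n - (n - (2*c+1)) + 1) * ((n - (2*c+1)) choose (m - 1))
        + 2 ^ (n - (n - (2*c+1))) * (\<Sum>j<m-1. (n - (2*c+1)) choose j)"
      unfolding Q_def by (intro card_not_Q_le m) simp
    also have "n - (n - (2*c+1)) = 2 * c + 1" using nc by simp
    finally show ?thesis unfolding u_def by simp
  qed
  have ne: "{} \<notin> F" if F: "F \<subseteq> Pow {1..n}" "matching_number F < s" "card F = ?e" for F
  proof
    assume e: "{} \<in> F"
    have "\<exists>F'\<subseteq>Pow {1..n}. card F < card F' \<and> (\<forall>M\<subseteq>F'. disjoint M \<longrightarrow> card M < s)"
    proof (rule empty_set_extend[OF _ F(1) e])
      show "card M < s" if "M \<subseteq> F" "disjoint M" for M
        using F(2) that unfolding matching_number_less_iff_card[OF fin[OF F(1)]] by blast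
      fix k assume k: "k \<le> card {1..n}" "k \<le> card (Pow {1..n} - F)"
      show "s + k \<le> card {1..n} + 1 + k div 2"
      proof (cases "m = 1")
        case True
        hence "k \<le> 2 * c + 2" using k(2) few[OF F(1,3)] unfolding u_def by simp
        thus ?thesis using n True by simp
      next
        case False
        hence "2 * s \<le> m * s" using m by (intro mult_le_mono1) simp
        hence "2 * s \<le> n" using n by linarith
        moreover have "k \<le> n" using k(1) by simp
        ultimately have "s + k \<le> n + 1 + k div 2" by linarith
        thus ?thesis by simp
      qed
    qed simp
    then obtain F' where F': "F' \<subseteq> Pow {1..n}" "card F < card F'" "\<forall>M\<subseteq>F'. disjoint M \<longrightarrow> card M < s"
      by blast
    hence "matching_number F' < s" by (simp add: matching_number_less_iff_card[OF fin[OF F'(1)]])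
    hence "card F' \<le> ?e" by (rule max_family_size_attained(2)[OF s1 F'(1)])
    thus False using F'(2) F(3) by simp
  qed
  have core: "F = Q \<or> c = 1 \<and> F = W"
    if F: "F \<subseteq> Pow {1..n}" "matching_number F < s" "card F = ?e"
      and sw: "\<And>A x y. A \<in> F \<Longrightarrow> x \<in> A \<Longrightarrow> y \<notin> A \<Longrightarrow> 1 \<le> y \<Longrightarrow> y < x \<Longrightarrow> insert y (A - {x}) \<in> F" for F
  proof -
    interpret compressed_family F n
    proof
      show "B \<in> F" if "A \<in> F" "A \<subseteq> B" "B \<subseteq> {1..n}" for A B
        using maximum_family_upward_closed[OF F(1) ne[OF F] F(2,3) s1 that] .
    qed (use F sw in auto)
    have nm: "\<not> has_matching s F" using F(2) matching_number_less_iff[OF fin[OF F(1)] ne[OF F]] by simp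
    have "(\<forall>X\<in>F. 2 * m \<le> card X + card (X \<inter> {1..n-(2*c+1)})) \<or> c = 1 \<and> (\<forall>X\<in>F. m \<le> card (X \<inter> {1..n-2}))"
      using few[OF F(1,3)] u1 u2 by (intro few_missing_sets_structure[OF n m c L s nm]) linarith+
    hence "F \<subseteq> Q \<or> c = 1 \<and> F \<subseteq> W" using F(1) unfolding Q_def W_def by blast
    moreover have "F = Q" if "F \<subseteq> Q"
      using card_seteq[OF fin[OF subQ] that] Qe F(3) by simp
    moreover have "F = W" if "c = 1" "F \<subseteq> W"
      using card_seteq[OF fin[OF subW] that(2)] Qe F(3) cW[OF that(1)] by simp
    ultimately show ?thesis by blast
  qed
  show e: "?e = card Q"
  proof -
    obtain F where F: "F \<subseteq> Pow {1..n}" "matching_number F < s" "card F = ?e"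
      using max_family_size_attained(1)[OF s1] by blast
    have "\<not> has_matching s F" using F(2) matching_number_less_iff[OF fin[OF F(1)] ne[OF F]] by simp
    from exists_swap_closed_family[OF F(1) ne[OF F] this]
    obtain F' where F'_all: "F' \<subseteq> Pow {1..n} \<and> {} \<notin> F' \<and> \<not> has_matching s F' \<and> card F' = card F \<and>
      (\<forall>A x y. A \<in> F' \<longrightarrow> x \<in> A \<longrightarrow> y \<notin> A \<longrightarrow> 1 \<le> y \<longrightarrow> y < x \<longrightarrow> insert y (A - {x}) \<in> F')"
      by (rule exE)
    hence F': "F' \<subseteq> Pow {1..n}" "{} \<notin> F'" "\<not> has_matching s F'" "card F' = card F"
      and sw: "\<And>A x y. A \<in> F' \<Longrightarrow> x \<in> A \<Longrightarrow> y \<notin> A \<Longrightarrow> 1 \<le> y \<Longrightarrow> y < x \<Longrightarrow> insert y (A - {x}) \<in> F'"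
      by simp_all
    have "matching_number F' < s"
      using F'(3) matching_number_less_iff[OF fin[OF F'(1)] F'(2)] by simp
    moreover have "card F' = ?e" using F'(4) F(3) by simp
    ultimately have "F' = Q \<or> c = 1 \<and> F' = W" by (intro core[OF F'(1)] sw)
    thus ?thesis using cW \<open>card F' = ?e\<close> by auto
  qed
  have only: "F = Q \<or> c = 1 \<and> F = W"
    if F: "F \<subseteq> Pow {1..n}" "shifted F" "matching_number F < s" "card F = ?e" for F
  proof (rule core[OF F(1,3,4)])
    show "insert y (A - {x}) \<in> F" if "A \<in> F" "x \<in> A" "y \<notin> A" "1 \<le> y" "y < x" for A x y
    proof (rule shifted_swap[OF F(2) that(1) _ _ that(2-)])
      have "A \<subseteq> {1..n}" using F(1) that(1) by blast
      thus "finite A" "A \<subseteq> {1..}" using finite_subset by auto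
    qed
  qed
  have "shifted Q" "shifted W" unfolding Q_def W_def by (rule shifted_Q shifted_W)+
  hence Q: "Q \<subseteq> Pow {1..n} \<and> shifted Q \<and> matching_number Q < s \<and> card Q = ?e"
    and W: "c = 1 \<Longrightarrow> W \<subseteq> Pow {1..n} \<and> shifted W \<and> matching_number W < s \<and> card W = ?e"
    using subQ subW mQ mW e cW by simp_all
  show "{F. F \<subseteq> Pow {1..n} \<and> shifted F \<and> matching_number F < s \<and> card F = ?e}
      = (if c = 1 then {Q, W} else {Q})" (is "?S = ?R")
  proof
    show "?S \<subseteq> ?R"
    proof
      fix F assume "F \<in> ?S"
      hence "F = Q \<or> c = 1 \<and> F = W" by (intro only) simp_all
      thus "F \<in> ?R" by (cases "c = 1") simp_all
    qed
    show "?R \<subseteq> ?S" using Q W by (cases "c = 1") simp_all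
  qed
qed

theorem theorem1:
  fixes m c :: nat
  assumes "m \<ge> 1" and "c \<ge> 1"
  shows "\<exists>s0::nat. \<forall>s\<ge>s0. \<forall>n l. n = m * s + c \<longrightarrow> l = s - c \<longrightarrow>
    max_family_size n s = card (Q_family m s l) \<and>
    (c \<ge> 2 \<longrightarrow>
      {F. F \<subseteq> Pow {1..n} \<and> shifted F \<and> matching_number F < s \<and> card F = max_family_size n s}
        = {Q_family m s l}) \<and>
    (c = 1 \<longrightarrow>
      {F. F \<subseteq> Pow {1..n} \<and> shifted F \<and> matching_number F < s \<and> card F = max_family_size n s}
        = {Q_family m s l, W_family m s l})"
proof -
  define L where "L = (2 * c + 3) * m ^ (m - 1)"
  have mp: "1 \<le> m ^ (m - 1)" using assms(1) by simp
  have L1: "(2 * c + 2) * m ^ (m - 1) < L"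
    unfolding L_def using mp by (intro mult_strict_right_mono) auto
  have "(2 * c + 3) * 1 \<le> L" unfolding L_def using mp by (intro mult_le_mono2)
  hence L2: "2 * c + 1 \<le> L" by simp
  note bounds = eventually_bounds[OF assms(1) L1]
  obtain s0 where s0: "\<And>s. s \<ge> s0 \<Longrightarrow>
      (2 * c + 2) * ((m * s + c - (2 * c + 1)) choose (m - 1))
        + 2 ^ (2 * c + 1) * (\<Sum>j<m-1. (m * s + c - (2 * c + 1)) choose j)
      < L * ((s - L) choose (m - 1))
    \<and> (2 * c + 2) * ((m * s + c - (2 * c + 1)) choose (m - 1))
        + 2 ^ (2 * c + 1) * (\<Sum>j<m-1. (m * s + c - (2 * c + 1)) choose j)
      < (2 * c + 3) * ((m * s + c - (L + ((m - 1) * L + m) + m - 1)) choose (m - 1))"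
    using eventually_conj[OF bounds] unfolding eventually_sequentially by blast
  show ?thesis
  proof (intro exI[of _ "max s0 (L + 2)"] allI impI)
    fix s n l :: nat
    assume s: "max s0 (L + 2) \<le> s" and n: "n = m * s + c" and l: "l = s - c"
    have sL: "L + 2 \<le> s" "s0 \<le> s" using s by auto
    have cs: "c \<le> s" using sL L2 by linarith
    note ext = extremal_families[OF n assms L2 sL(1) s0[OF sL(2), THEN conjunct1, folded n]
        s0[OF sL(2), THEN conjunct2, folded n], folded Q_family_eq[OF n cs], folded l]
    have W: "W_family m s l = {P. P \<subseteq> {1..n} \<and> m \<le> card (P \<inter> {1..n-2})}" if "c = 1"
      using W_family_eq[of n m s] n l that sL by simp
    show "max_family_size n s = card (Q_family m s l) \<and>
      (c \<ge> 2 \<longrightarrow>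
        {F. F \<subseteq> Pow {1..n} \<and> shifted F \<and> matching_number F < s \<and> card F = max_family_size n s}
          = {Q_family m s l}) \<and>
      (c = 1 \<longrightarrow>
        {F. F \<subseteq> Pow {1..n} \<and> shifted F \<and> matching_number F < s \<and> card F = max_family_size n s}
          = {Q_family m s l, W_family m s l})"
    proof (intro conjI impI)
      show "max_family_size n s = card (Q_family m s l)" by (rule ext(1))
      show "{F. F \<subseteq> Pow {1..n} \<and> shifted F \<and> matching_number F < s \<and> card F = max_family_size n s}
          = {Q_family m s l}" if "c \<ge> 2"
        using ext(2) that by simp
      show "{F. F \<subseteq> Pow {1..n} \<and> shifted F \<and> matching_number F < s \<and> card F = max_family_size n s}
          = {Q_family m s l, W_family m s l}" if "c = 1"
        unfolding W[OF that] using ext(2) that by simp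
    qed
  qed
qed

end
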